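(* Let $A=\langle a,b\mid\ \rangle$ be the free group of rank two and $C\le A$ the subgroup generated by $\alpha_1,\dots,\alpha_m$, where $m\ge8$, $s\ge10$, $\alpha_i=a^{k_{i1}^{(1)}}b^{k_{i1}^{(2)}}\cdots a^{k_{is}^{(1)}}b^{k_{is}^{(2)}}$ with nonzero integers $k_{ij}^{(t)}$ satisfying: (A) for each $t\in\{1,2\}$, the $sm+\binom m2$ numbers $|k_{ij}^{(t)}|$ ($1\le i\le m,1\le j\le s$) together with $|k_{i1}^{(1)}-k_{i'1}^{(1)}|$ ($i<i'$) when $t=1$, resp. $|k_{is}^{(2)}-k_{i's}^{(2)}|$ ($i<i'$) when $t=2$, are pairwise distinct; (B) for $i\le 8$ and $t\in\{1,2\}$ the integers $k_{i1}^{(t)},\dots,k_{is}^{(t)}$ have a common sign $\epsilon_{it}$; (C) $\epsilon_{i1}=\epsilon_{i2}=1$ for $i\le4$ and $\epsilon_{i1}=-\epsilon_{i2}=1$ for $5\le i\le 8$. Then $C$ is multi-malnormal in $A$.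
   Context: A normal subsemigroup of a group $H$ is a (possibly empty) subset closed under multiplication and under conjugation by elements of $H$. A subgroup $C$ of a group $A$ is multi-malnormal in $A$ if for every normal subsemigroup $C'$ of $C$ with $1\notin C'$, every $n\ge1$, all $c_1,\dots,c_n\in C'$ and all $a_1,\dots,a_n\in A\setminus C$, one has $c_1^{a_1}\cdots c_n^{a_n}\in A\setminus C$, where $x^y=y^{-1}xy$. *)

theory Defs
  imports "HOL-Algebra.Algebra"
begin

text \<open>A letter is a pair (g, e): g = False means generator a, g = True means b;
  e = True means the inverse of the generator.  Elements are freely reduced words.\<close>

type_synonym letter = "bool \<times> bool"

fun push :: "letter \<Rightarrow> letter list \<Rightarrow> letter list" where
  "push x [] = [x]"
| "push x (y # ys) = (if fst x = fst y \<and> snd x \<noteq> snd y then ys else x # y # ys)"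

definition reduce :: "letter list \<Rightarrow> letter list" where
  "reduce xs = foldr push xs []"

definition reduced :: "letter list \<Rightarrow> bool" where
  "reduced xs \<longleftrightarrow> (\<forall>i. Suc i < length xs \<longrightarrow>
      \<not> (fst (xs ! i) = fst (xs ! Suc i) \<and> snd (xs ! i) \<noteq> snd (xs ! Suc i)))"

definition F2 :: "letter list monoid" where
  "F2 = \<lparr>carrier = {w. reduced w}, monoid.mult = (\<lambda>x y. reduce (x @ y)), one = []\<rparr>"

definition gen_a :: "letter list" where "gen_a = [(False, False)]"
definition gen_b :: "letter list" where "gen_b = [(True, False)]"

definition conjg :: "('a, 'b) monoid_scheme \<Rightarrow> 'a \<Rightarrow> 'a \<Rightarrow> 'a" where
  "conjg G x y = inv\<^bsub>G\<^esub> y \<otimes>\<^bsub>G\<^esub> x \<otimes>\<^bsub>G\<^esub> y"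

definition listprod :: "('a, 'b) monoid_scheme \<Rightarrow> 'a list \<Rightarrow> 'a" where
  "listprod G xs = foldr (\<lambda>x acc. x \<otimes>\<^bsub>G\<^esub> acc) xs \<one>\<^bsub>G\<^esub>"

definition normal_subsemigroup :: "('a, 'b) monoid_scheme \<Rightarrow> 'a set \<Rightarrow> 'a set \<Rightarrow> bool" where
  "normal_subsemigroup G H S \<longleftrightarrow> S \<subseteq> H
     \<and> (\<forall>x\<in>S. \<forall>y\<in>S. x \<otimes>\<^bsub>G\<^esub> y \<in> S)
     \<and> (\<forall>x\<in>S. \<forall>h\<in>H. conjg G x h \<in> S)"

definition multi_malnormal :: "('a, 'b) monoid_scheme \<Rightarrow> 'a set \<Rightarrow> bool" where
  "multi_malnormal G C \<longleftrightarrow> subgroup C G \<and>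
     (\<forall>C'. normal_subsemigroup G C C' \<and> \<one>\<^bsub>G\<^esub> \<notin> C' \<longrightarrow>
        (\<forall>cs as. length cs = length as \<and> cs \<noteq> [] \<and> set cs \<subseteq> C' \<and> set as \<subseteq> carrier G - C
            \<longrightarrow> listprod G (map2 (conjg G) cs as) \<in> carrier G - C))"

definition alpha :: "(nat \<Rightarrow> nat \<Rightarrow> int) \<Rightarrow> (nat \<Rightarrow> nat \<Rightarrow> int) \<Rightarrow> nat \<Rightarrow> nat \<Rightarrow> letter list" where
  "alpha k1 k2 s i = listprod F2
     (map (\<lambda>j. (gen_a [^]\<^bsub>F2\<^esub> k1 i j) \<otimes>\<^bsub>F2\<^esub> (gen_b [^]\<^bsub>F2\<^esub> k2 i j)) [1..<Suc s])"

end

theory Submission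
  imports Defs
begin

text \<open>The free group acts on the Bass-Serre tree of \<open>\<langle>a\<rangle> * \<langle>b\<rangle>\<close>, and \<open>C\<close> acts freely on a subtree
  \<open>Y\<close> whose quotient is a graph of girth \<open>2 s\<close>. By condition (A) a turn of \<open>Y\<close> is determined up to \<open>C\<close> by the
  power of \<open>a\<close> or \<open>b\<close> that it reads, so distinct translates of \<open>Y\<close> share at most one edge, while
  every nontrivial element of \<open>C\<close> moves the vertices of \<open>Y\<close> by at least 11. Consider an equation
  \<open>c1^a1 ... cn^an = c\<close> as a product of elements of stabilisers of translates of \<open>Y\<close>. Factors
  belonging to the same translate are merged, which never yields 1 inside \<open>C'\<close>, and Hurwitz moves
  are used to make the translates as close to a base vertex as possible. What remains is a closed
  polygon in the tree each of whose sides runs far along a translate that no vertex of the polygon is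
  nearer to than the ends of that side. Such a polygon cannot close up: by induction on the number of sides,
  the deepest side of any interval is almost completely visible from its two ends.\<close>

section \<open>Gates in tree metrics\<close>

text \<open>The obstacle is that conjugators may be long: the leg from a polygon vertex to the
  translate of its side has no bounded length and may follow other translates. Only minimality
  controls it. The distance from vertex number i to translate number j is the height that factor j
  would get from a Hurwitz move past the factors in between, so once no such move lowers a height, a
  leg cannot run along a translate at least as deep as its own, and its overlap with any other one
  is bounded by \<open>leg_overlap\<close>. In the induction, "almost completely" means up to 2 at
  each foot. A shallower side shifts the projection to the deepest translate by at most 1, so a side
  that brings it from 3 or more to at most 2 stops exactly at 2, and a segment of length 2 is longer
  than its projection to any third translate. The 11 comes from the worst case 2 + 4 + 2 + 2 = 10
  for the distance between the feet of an enclosed side. It requires closed paths of 12 syllables,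
  because a vertex may move by one less than the length of the path. The differences in (A) are the
  powers read when passing from one petal of the graph to another at an end of the base
  edge.\<close>

locale tree_metric =
  fixes V :: "'v set" and d :: "'v \<Rightarrow> 'v \<Rightarrow> nat"
  assumes d_eq_0: "\<lbrakk>x \<in> V; y \<in> V\<rbrakk> \<Longrightarrow> d x y = 0 \<longleftrightarrow> x = y"
    and d_sym: "d x y = d y x"
    and d_tri: "\<lbrakk>x \<in> V; y \<in> V; z \<in> V\<rbrakk> \<Longrightarrow> d x z \<le> d x y + d y z"
    and four_point: "\<lbrakk>x \<in> V; y \<in> V; z \<in> V; w \<in> V\<rbrakk> \<Longrightarrow>
      d x y + d z w \<le> max (d x z + d y w) (d x w + d y z)"
    and median: "\<lbrakk>x \<in> V; y \<in> V; z \<in> V\<rbrakk> \<Longrightarrow> \<exists>m\<in>V.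
      d x y = d x m + d m y \<and> d x z = d x m + d m z \<and> d y z = d y m + d m z"
begin

definition convex :: "'v set \<Rightarrow> bool" where
  "convex Z \<longleftrightarrow> Z \<subseteq> V \<and> Z \<noteq> {} \<and>
     (\<forall>x\<in>Z. \<forall>y\<in>Z. \<forall>u\<in>V. d x y = d x u + d u y \<longrightarrow> u \<in> Z)"

text \<open>The nearest-point projection, characterised by lying on the geodesics from
  \<open>x\<close> to all points of \<open>Z\<close>; this form gives uniqueness and additivity of
  distances at once.\<close>

definition gate :: "'v set \<Rightarrow> 'v \<Rightarrow> 'v" where
  "gate Z x = (SOME g. g \<in> Z \<and> (\<forall>z\<in>Z. d x z = d x g + d g z))"

definition setdist :: "'v set \<Rightarrow> 'v \<Rightarrow> nat" where
  "setdist Z x = d x (gate Z x)"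

lemma convex_subset: "\<lbrakk>convex Z; x \<in> Z\<rbrakk> \<Longrightarrow> x \<in> V"
  unfolding convex_def by blast

lemma d_self: "x \<in> V \<Longrightarrow> d x x = 0"
  using d_eq_0 by blast

text \<open>Any nearest point \<open>g\<close> works: the median of \<open>x\<close>,
  \<open>g\<close>, \<open>z\<close> is in \<open>Z\<close> by convexity and lies between
  \<open>x\<close> and \<open>g\<close>, so it equals \<open>g\<close>; and it lies between
  \<open>x\<close> and \<open>z\<close>.\<close>

lemma gate_exists:
  assumes Z: "convex Z" and x: "x \<in> V"
  shows "\<exists>g. g \<in> Z \<and> (\<forall>z\<in>Z. d x z = d x g + d g z)"
proof -
  have ZV: "Z \<subseteq> V" and "Z \<noteq> {}" using Z by (auto simp: convex_def)
  then obtain g where g: "g \<in> Z" and gmin: "\<And>z. z \<in> Z \<Longrightarrow> d x g \<le> d x z"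
    using ex_has_least_nat[of "\<lambda>z. z \<in> Z" _ "d x"] by blast
  have "d x z = d x g + d g z" if z: "z \<in> Z" for z
  proof -
    have V: "g \<in> V" "z \<in> V" using g z ZV by auto
    obtain p where p: "p \<in> V" "d x g = d x p + d p g" "d x z = d x p + d p z" "d g z = d g p + d p z"
      using median[OF x V] by blast
    have "p \<in> Z" using Z g z p unfolding convex_def by blast
    then have "d p g = 0" using gmin[of p] p(2) by linarith
    then have "p = g" using d_eq_0[of p g] p(1) g ZV by auto
    then show ?thesis using p(3) by blast
  qed
  then show ?thesis using g by blast
qed

lemma gate_props:
  assumes "convex Z" "x \<in> V"
  shows "gate Z x \<in> Z" "\<And>z. z \<in> Z \<Longrightarrow> d x z = d x (gate Z x) + d (gate Z x) z"
  using someI_ex[OF gate_exists[OF assms]] unfolding gate_def by blast+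

lemma gate_in_V: "\<lbrakk>convex Z; x \<in> V\<rbrakk> \<Longrightarrow> gate Z x \<in> V"
  using gate_props(1) convex_subset by blast

lemma setdist_le: "\<lbrakk>convex Z; x \<in> V; z \<in> Z\<rbrakk> \<Longrightarrow> setdist Z x \<le> d x z"
  using gate_props(2)[of Z x z] unfolding setdist_def by linarith

lemma gate_eqI:
  assumes Z: "convex Z" and x: "x \<in> V" and g: "g \<in> Z" "\<And>z. z \<in> Z \<Longrightarrow> d x z = d x g + d g z"
  shows "gate Z x = g"
proof -
  have "d g (gate Z x) = 0"
    using g(2)[OF gate_props(1)[OF Z x]] gate_props(2)[OF Z x g(1)] by linarith
  then show ?thesis using d_eq_0 convex_subset[OF Z] g(1) gate_in_V[OF Z x] by metis
qed

text \<open>With gates g and h, the sum d x h + d y g counts d g h twice, hence exceeds d x g + d h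
  y. The four-point inequality then leaves only the alternative that bounds \<open>d x y\<close>
  from below.\<close>

lemma gates_distinct_geodesic:
  assumes Z: "convex Z" and x: "x \<in> V" and y: "y \<in> V" and ne: "gate Z x \<noteq> gate Z y"
  shows "d x y = d x (gate Z x) + d (gate Z x) (gate Z y) + d (gate Z y) y"
proof -
  let ?g = "gate Z x" and ?h = "gate Z y"
  have V: "?g \<in> V" "?h \<in> V" using gate_in_V Z x y by auto
  have 1: "d x ?h = d x ?g + d ?g ?h" using gate_props Z x y by blast
  have 2: "d y ?g = d y ?h + d ?h ?g" using gate_props Z x y by blast
  have pos: "d ?g ?h > 0" using d_eq_0 V ne by blast
  have "d x ?h + d y ?g \<le> max (d x y + d ?h ?g) (d x ?g + d ?h y)"
    using four_point[of x ?h y ?g] x y V by blast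
  then have "d x y \<ge> d x ?g + d ?g ?h + d ?h y"
    using 1 2 pos d_sym[of ?g ?h] d_sym[of y ?h] by auto
  moreover have "d x y \<le> d x ?h + d ?h y" using d_tri[of x ?h y] x y V by blast
  ultimately show ?thesis using 1 by simp
qed

lemma gate_mem_of_gates_distinct:
  assumes Z: "convex Z" and W: "convex W" and x: "x \<in> W" and y: "y \<in> W"
    and ne: "gate Z x \<noteq> gate Z y"
  shows "gate Z x \<in> W"
proof -
  have V: "x \<in> V" "y \<in> V" using convex_subset W x y by blast+
  let ?g = "gate Z x"
  have "d ?g y = d ?g (gate Z y) + d (gate Z y) y"
    using gate_props(2)[OF Z V(2) gate_props(1)[OF Z V(1)]] d_sym by (metis add.commute)
  then have "d x y = d x ?g + d ?g y"
    using gates_distinct_geodesic[OF Z V ne] by linarith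
  then show ?thesis using W x y gate_in_V[OF Z V(1)] unfolding convex_def by blast
qed

end

section \<open>Polygons with deep sides do not close up\<close>

text \<open>Side \<open>j\<close> goes from \<open>c (j - 1)\<close> along a leg to its gate in
  \<open>Z j\<close>, inside \<open>Z j\<close> to the gate of \<open>c j\<close>, and along a
  second leg to \<open>c j\<close>. The bound 11 is the least one for which the estimate in
  \<open>no_enclosed_side\<close> works.\<close>

locale polygon = tree_metric V d for V :: "'v set" and d :: "'v \<Rightarrow> 'v \<Rightarrow> nat" +
  fixes n :: nat and c :: "nat \<Rightarrow> 'v" and Z :: "nat \<Rightarrow> 'v set"
  assumes c_V: "i \<le> n \<Longrightarrow> c i \<in> V"
    and Z_convex: "j \<in> {1..n} \<Longrightarrow> convex (Z j)"
    and nearest_left: "\<lbrakk>j \<in> {1..n}; i \<le> n\<rbrakk> \<Longrightarrow> setdist (Z j) (c (j - 1)) \<le> setdist (Z j) (c i)"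
    and nearest_right: "\<lbrakk>j \<in> {1..n}; i \<le> n\<rbrakk> \<Longrightarrow> setdist (Z j) (c j) \<le> setdist (Z j) (c i)"
    and thin: "\<lbrakk>j \<in> {1..n}; k \<in> {1..n}; j \<noteq> k; x \<in> Z k; y \<in> Z k\<rbrakk> \<Longrightarrow>
      d (gate (Z j) x) (gate (Z j) y) \<le> 1"
    and long: "j \<in> {1..n} \<Longrightarrow> d (gate (Z j) (c (j - 1))) (gate (Z j) (c j)) \<ge> 11"
begin

abbreviation pr :: "nat \<Rightarrow> 'v \<Rightarrow> 'v" where "pr j \<equiv> gate (Z j)"
abbreviation depth :: "nat \<Rightarrow> nat" where "depth j \<equiv> setdist (Z j) (c j)"

lemma depth_left: "j \<in> {1..n} \<Longrightarrow> setdist (Z j) (c (j - 1)) = depth j"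
  using nearest_left[of j j] nearest_right[of j "j - 1"] by (auto intro: le_antisym)

text \<open>In both lemmas \<open>a\<close> is one of the two indices of side \<open>f\<close>, so that the segment from
  \<open>c a\<close> to its gate is one of the two legs of that side.\<close>

lemma leg_avoids_deeper:
  assumes f: "f \<in> {1..n}" and k: "k \<in> {1..n}" and le: "depth f \<le> depth k"
    and a: "a = f \<or> a = f - 1"
  shows "pr k (c a) = pr k (pr f (c a))"
proof (rule ccontr)
  assume ne: "pr k (c a) \<noteq> pr k (pr f (c a))"
  have an: "a \<le> n" using a f by auto
  have V: "c a \<in> V" "pr f (c a) \<in> V" using c_V an gate_in_V Z_convex f by auto
  have D: "d (c a) (pr f (c a)) = depth f"
    using a depth_left[OF f] by (auto simp: setdist_def)
  \<comment> \<open>If the two gates differed, the leg would need at least \<open>depth k\<close> to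
    reach \<open>Z k\<close> and then a positive length inside it, more than its total length
    \<open>depth f\<close>.\<close>
  have "d (c a) (pr k (c a)) \<ge> depth k"
    using nearest_right[OF k an] by (simp add: setdist_def)
  moreover have "d (pr k (c a)) (pr k (pr f (c a))) > 0"
    using d_eq_0[of "pr k (c a)" "pr k (pr f (c a))"] ne gate_in_V Z_convex[OF k] V by auto
  ultimately show False
    using gates_distinct_geodesic[OF Z_convex[OF k] V ne] D le by simp
qed

lemma leg_overlap:
  assumes f: "f \<in> {1..n}" and l: "l \<in> {1..n}"
    and a: "a = f \<or> a = f - 1" and b: "b = l \<or> b = l - 1"
  shows "d (pr l (c a)) (pr l (pr f (c a))) \<le> d (pr l (c b)) (pr l (pr f (c a)))"
proof (cases "pr l (c a) = pr l (pr f (c a))")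
  case True
  have "c a \<in> V" using a f by (auto intro: c_V)
  then have "d (pr l (c a)) (pr l (pr f (c a))) = 0"
    using True d_self[OF gate_in_V[OF Z_convex[OF l]]] by metis
  then show ?thesis by simp
next
  case False
  have an: "a \<le> n" and bn: "b \<le> n" using a b f l by auto
  have V: "c a \<in> V" "pr f (c a) \<in> V" "c b \<in> V" using c_V an bn gate_in_V Z_convex f by auto
  have Vl: "pr l (c a) \<in> V" "pr l (pr f (c a)) \<in> V" "pr l (c b) \<in> V"
    using gate_in_V Z_convex[OF l] V by auto
  have Da: "d (c a) (pr f (c a)) = depth f"
    using a depth_left[OF f] by (auto simp: setdist_def)
  have Db: "d (c b) (pr l (c b)) = depth l"
    using b depth_left[OF l] by (auto simp: setdist_def)
  have 1: "depth l \<le> d (c a) (pr l (c a))"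
    using nearest_right[OF l an] by (simp add: setdist_def)
  \<comment> \<open>The foot of the leg can also be reached from \<open>c b\<close> through
    \<open>Z l\<close>, and this route is no shorter than \<open>depth f\<close>. Both routes share
    the part after \<open>Z l\<close>, and the part before it is at least \<open>depth l\<close> for
    \<open>c a\<close> and equal to \<open>depth l\<close> for \<open>c b\<close>.\<close>
  have "depth f \<le> d (c b) (pr f (c a))"
    using nearest_right[OF f bn] setdist_le[OF Z_convex[OF f] V(3)]
      gate_props(1)[OF Z_convex[OF f] V(1)] by (meson le_trans)
  also have "\<dots> \<le> d (c b) (pr l (c b)) + d (pr l (c b)) (pr l (pr f (c a)))
      + d (pr l (pr f (c a))) (pr f (c a))"
    using d_tri[OF V(3) Vl(3) V(2)] d_tri[OF Vl(3) Vl(2) V(2)] by linarith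
  finally show ?thesis
    using gates_distinct_geodesic[OF Z_convex[OF l] V(1,2) False] Da Db 1 by simp
qed

text \<open>Side \<open>l\<close> is enclosed between sides \<open>f\<close> and \<open>k\<close>, which share an edge at distance 2 from the
  foot of \<open>k\<close>. The path \<open>c a\<close>, foot of \<open>f\<close>, \<open>w\<close>, foot of \<open>k\<close>, \<open>c b\<close> would have to follow side
  \<open>l\<close> almost completely, but it can do so along only one of the two legs.\<close>

lemma no_enclosed_side:
  assumes f: "f \<in> {1..n}" and k: "k \<in> {1..n}" and l: "l \<in> {1..n}" and lf: "l \<noteq> f" and lk: "l \<noteq> k"
    and a: "a = f \<or> a = f - 1" and b: "b = k \<or> b = k - 1"
    and a': "a' = l \<or> a' = l - 1" and b': "b' = l \<or> b' = l - 1"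
    and L: "d (pr l (c a')) (pr l (c b')) \<ge> 11"
    and w: "w = pr k (c a)" "w \<in> Z f" and two: "d w (pr k (c b)) = 2"
    and ga: "d (pr l (c a)) (pr l (c a')) \<le> 2" and gb: "d (pr l (c b)) (pr l (c b')) \<le> 2"
  shows False
proof -
  let ?g = "pr l (c a)" and ?z = "pr l (c b)"
  let ?q = "pr f (c a)" and ?p = "pr k (c b)"
  let ?h1 = "pr l ?q" and ?h2 = "pr l w" and ?h3 = "pr l ?p"
  have bnd: "a \<le> n" "b \<le> n" "a' \<le> n" "b' \<le> n" using a b a' b' f k l by auto
  have V: "c a \<in> V" "c b \<in> V" "c a' \<in> V" "c b' \<in> V" using bnd c_V by auto
  have Vq: "?q \<in> V" "?p \<in> V" "w \<in> V" using V w gate_in_V Z_convex f k by auto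
  have Vl: "?g \<in> V" "?z \<in> V" "?h1 \<in> V" "?h2 \<in> V" "?h3 \<in> V" "pr l (c a') \<in> V" "pr l (c b') \<in> V"
    using V Vq gate_in_V Z_convex[OF l] by auto
  have wk: "w \<in> Z k" "?p \<in> Z k" "?q \<in> Z f"
    using w gate_props(1) Z_convex f k V by auto
  have h12: "d ?h1 ?h2 \<le> 1" using thin[OF l f lf wk(3) w(2)] .
  have h23: "d ?h2 ?h3 \<le> 1" using thin[OF l k lk wk(1) wk(2)] .
  have leg1: "d ?g ?h1 \<le> d (pr l (c b')) ?h1" using leg_overlap[OF f l a b'] .
  have leg2: "d ?z ?h3 \<le> d (pr l (c a')) ?h3" using leg_overlap[OF k l b a'] .
  have "w \<noteq> ?p" using two d_self Vq by force
  then have geo: "d (c a) (c b) = d (c a) w + 2 + d ?p (c b)"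
    using gates_distinct_geodesic[OF Z_convex[OF k] V(1,2)] w two by simp
  \<comment> \<open>Otherwise the stretches from \<open>c a\<close> to \<open>w\<close> and from
    \<open>?p\<close> to \<open>c b\<close> both follow \<open>Z l\<close>, and passing from
    \<open>?h2\<close> to \<open>?h3\<close> inside \<open>Z l\<close>, at cost at most 1, would
    undercut the geodesic, which spends 2 between \<open>w\<close> and \<open>?p\<close>.\<close>
  have "?g = ?h2 \<or> ?z = ?h3"
  proof (rule ccontr)
    assume "\<not> ?thesis"
    then have 1: "d (c a) w = d (c a) ?g + d ?g ?h2 + d ?h2 w"
      and 2: "d (c b) ?p = d (c b) ?z + d ?z ?h3 + d ?h3 ?p"
      using gates_distinct_geodesic[OF Z_convex[OF l] V(1) Vq(3)]
        gates_distinct_geodesic[OF Z_convex[OF l] V(2) Vq(2)] by blast+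
    have "d (c a) (c b) \<le> d (c a) ?g + d ?g ?h2 + d ?h2 ?h3 + d ?h3 ?z + d ?z (c b)"
      using d_tri[OF V(1) Vl(1) V(2)] d_tri[OF Vl(1) Vl(4) V(2)] d_tri[OF Vl(4) Vl(5) V(2)]
        d_tri[OF Vl(5) Vl(2) V(2)] by linarith
    then show False
      using geo 1 2 h23 d_sym[of "c b" ?p] d_sym[of "c b" ?z] d_sym[of ?z ?h3] by linarith
  qed
  then show False
  proof
    \<comment> \<open>The feet of side \<open>l\<close> are then at distance at most 2 + 1 + 3 + 2 =
      8.\<close>
    assume "?g = ?h2"
    then have "d ?g ?h3 \<le> 1" using h23 by simp
    then have "d ?z ?h3 \<le> 3"
      using leg2 d_tri[OF Vl(6) Vl(1) Vl(5)] ga d_sym[of ?g "pr l (c a')"] by linarith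
    then show False
      using L d_tri[OF Vl(6) Vl(1) Vl(7)] d_tri[OF Vl(1) Vl(5) Vl(7)] d_tri[OF Vl(5) Vl(2) Vl(7)]
        ga gb \<open>d ?g ?h3 \<le> 1\<close> d_sym[of ?g "pr l (c a')"] d_sym[of ?z ?h3] by linarith
  next
    \<comment> \<open>Here the bound is 2 + 4 + 2 + 2 = 10, the case that determines the constant
      11.\<close>
    assume "?z = ?h3"
    then have z1: "d ?h1 ?z \<le> 2"
      using h12 h23 d_tri[OF Vl(3) Vl(4) Vl(5)] by simp
    then have "d ?g ?h1 \<le> 4"
      using leg1 d_tri[OF Vl(7) Vl(2) Vl(3)] gb d_sym[of ?z "pr l (c b')"] d_sym[of ?z ?h1] by linarith
    then show False
      using L d_tri[OF Vl(6) Vl(1) Vl(7)] d_tri[OF Vl(1) Vl(3) Vl(7)] d_tri[OF Vl(3) Vl(2) Vl(7)]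
        ga gb z1 d_sym[of ?g "pr l (c a')"] by linarith
  qed
qed

text \<open>By \<open>leg_avoids_deeper\<close> the legs of \<open>f\<close> do not change the
  projection to \<open>Z k\<close>; only the part inside \<open>Z f\<close> does, by at most 1. As
  two points of \<open>Z f\<close> then have different gates in \<open>Z k\<close>, these gates
  belong to \<open>Z f\<close> as well.\<close>

lemma jump:
  assumes f: "f \<in> {1..n}" and k: "k \<in> {1..n}" and fk: "f \<noteq> k" and le: "depth f \<le> depth k"
    and a: "{a, a'} = {f, f - 1}" and v: "v \<in> V"
    and far: "d (pr k (c a')) v \<ge> 3" and near: "d (pr k (c a)) v \<le> 2"
  shows "d (pr k (c a)) v = 2" "pr k (c a) \<in> Z f"
proof -
  have a1: "a = f \<or> a = f - 1" and a2: "a' = f \<or> a' = f - 1" using a by blast+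
  have bnd: "a \<le> n" "a' \<le> n" using a1 a2 f by auto
  have e1: "pr k (c a) = pr k (pr f (c a))" using leg_avoids_deeper[OF f k le a1] .
  have e2: "pr k (c a') = pr k (pr f (c a'))" using leg_avoids_deeper[OF f k le a2] .
  have V: "c a \<in> V" "c a' \<in> V" using c_V bnd by auto
  have Zf: "pr f (c a) \<in> Z f" "pr f (c a') \<in> Z f" using gate_props(1)[OF Z_convex[OF f]] V by auto
  have Vk: "pr k (c a) \<in> V" "pr k (c a') \<in> V" using gate_in_V Z_convex[OF k] V by auto
  have "d (pr k (c a')) (pr k (c a)) \<le> 1"
    using thin[OF k f _ Zf(2) Zf(1)] fk e1 e2 by simp
  then show "d (pr k (c a)) v = 2"
    using d_tri[OF Vk(2) Vk(1) v] far near by linarith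
  have "pr k (pr f (c a)) \<noteq> pr k (pr f (c a'))" using e1 e2 far near by force
  then show "pr k (c a) \<in> Z f"
    using gate_mem_of_gates_distinct[OF Z_convex[OF k] Z_convex[OF f] Zf] e1 by simp
qed

lemma deepest_exists:
  assumes "i < j"
  obtains l where "i < l" "l \<le> j" "\<And>l'. \<lbrakk>i < l'; l' \<le> j\<rbrakk> \<Longrightarrow> depth l' \<le> depth l"
proof -
  have ne: "finite {i<..j}" "{i<..j} \<noteq> {}" using assms by auto
  have "Max (depth ` {i<..j}) \<in> depth ` {i<..j}" using ne by (intro Max_in) auto
  then obtain l where l: "l \<in> {i<..j}" "Max (depth ` {i<..j}) = depth l" by blast
  have "depth l' \<le> depth l" if "i < l'" "l' \<le> j" for l'
    using Max_ge[of "depth ` {i<..j}" "depth l'"] ne that l(2) by auto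
  then show thesis using that l by auto
qed

text \<open>If \<open>c i\<close> projects to distance 3 or more from the left foot of
  \<open>k\<close>, take the last vertex before \<open>k\<close> that does so. The next side
  \<open>f\<close> brings the projection to distance exactly 2, so \<open>f\<close> is not
  \<open>k - 1\<close> and some side lies strictly between \<open>f\<close> and \<open>k\<close>.
  The deepest of these is visible from \<open>c f\<close> and \<open>c (k - 1)\<close> by the
  induction hypothesis, which \<open>no_enclosed_side\<close> excludes. The right half is the mirror
  image, with the first distant vertex after \<open>k\<close>.\<close>

lemma deepest_is_shell:
  assumes "i < k" "k \<le> j" "j \<le> n" "\<And>l. \<lbrakk>i < l; l \<le> j\<rbrakk> \<Longrightarrow> depth l \<le> depth k"
  shows "d (pr k (c i)) (pr k (c (k - 1))) \<le> 2 \<and> d (pr k (c j)) (pr k (c k)) \<le> 2"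
  using assms
proof (induction "j - i" arbitrary: i j k rule: less_induct)
  case less
  have k: "k \<in> {1..n}" using less.prems by auto
  have Vk: "pr k (c t) \<in> V" if "t \<le> n" for t using gate_in_V Z_convex[OF k] c_V that by auto
  have "d (pr k (c i)) (pr k (c (k - 1))) \<le> 2"
  proof (rule ccontr)
    let ?far = "\<lambda>t. d (pr k (c t)) (pr k (c (k - 1))) \<ge> 3"
    assume "\<not> ?thesis"
    then have P: "i \<le> i \<and> i < k \<and> ?far i" using less.prems by auto
    have "\<exists>t. (i \<le> t \<and> t < k \<and> ?far t) \<and> (\<forall>t'. i \<le> t' \<and> t' < k \<and> ?far t' \<longrightarrow> t' \<le> t)"
      by (rule ex_has_greatest_nat[of _ i _ k]) (use P in auto)
    then obtain t where t: "i \<le> t" "t < k" "?far t"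
      and tmax: "\<And>t'. \<lbrakk>i \<le> t'; t' < k; ?far t'\<rbrakk> \<Longrightarrow> t' \<le> t" by blast
    define f where "f = t + 1"
    have "t \<noteq> k - 1" using t(3) d_self Vk[of "k - 1"] k by auto
    then have fk: "f < k" using t f_def by simp
    have f: "f \<in> {1..n}" using fk k f_def by auto
    have near: "d (pr k (c f)) (pr k (c (k - 1))) \<le> 2"
      using tmax[of f] fk t f_def by force
    have dep: "depth f \<le> depth k" using less.prems t fk f_def by auto
    have j2: "d (pr k (c f)) (pr k (c (k - 1))) = 2" "pr k (c f) \<in> Z f"
      using jump[OF f k _ dep _ _ _ near, of t] t fk Vk[of "k - 1"] k f_def by auto
    have "f \<noteq> k - 1" using j2(1) d_self Vk[of "k - 1"] k by auto
    then have fk1: "f < k - 1" using fk by simp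
    obtain l where l: "f < l" "l \<le> k - 1" "\<And>l'. \<lbrakk>f < l'; l' \<le> k - 1\<rbrakk> \<Longrightarrow> depth l' \<le> depth l"
      using deepest_exists[OF fk1] by blast
    have ln: "l \<in> {1..n}" using l k by auto
    have lk: "l \<noteq> k" "l \<noteq> f" using l(1,2) fk1 by auto
    have IH: "d (pr l (c f)) (pr l (c (l - 1))) \<le> 2" "d (pr l (c (k - 1))) (pr l (c l)) \<le> 2"
      using less.hyps[OF _ l(1,2) _ l(3)] less.prems t f_def by auto
    show False
      using no_enclosed_side[OF f k ln, of f "k - 1" "l - 1" l "pr k (c f)"] lk j2 IH long[OF ln] by auto
  qed
  moreover have "d (pr k (c j)) (pr k (c k)) \<le> 2"
  proof (rule ccontr)
    let ?far = "\<lambda>t. d (pr k (c t)) (pr k (c k)) \<ge> 3"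
    assume "\<not> ?thesis"
    then have P: "k \<le> j \<and> j \<le> j \<and> ?far j" using less.prems by auto
    have "\<exists>t. (k \<le> t \<and> t \<le> j \<and> ?far t) \<and> (\<forall>t'. k \<le> t' \<and> t' \<le> j \<and> ?far t' \<longrightarrow> t \<le> t')"
      using ex_has_least_nat[of "\<lambda>t. k \<le> t \<and> t \<le> j \<and> ?far t" j "\<lambda>t. t"] P by blast
    then obtain f where t: "k \<le> f" "f \<le> j" "?far f"
      and tmin: "\<And>t'. \<lbrakk>k \<le> t'; t' \<le> j; ?far t'\<rbrakk> \<Longrightarrow> f \<le> t'" by blast
    have "f \<noteq> k" using t(3) d_self Vk[of k] k by auto
    then have fk: "k < f" using t by simp
    have f: "f \<in> {1..n}" using fk t less.prems by auto
    have near: "d (pr k (c (f - 1))) (pr k (c k)) \<le> 2"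
      using tmin[of "f - 1"] fk t by force
    have dep: "depth f \<le> depth k" using less.prems t fk by auto
    have j2: "d (pr k (c (f - 1))) (pr k (c k)) = 2" "pr k (c (f - 1)) \<in> Z f"
      using jump[OF f k _ dep _ _ _ near, of f] t fk Vk[of k] k by auto
    have "f - 1 \<noteq> k" using j2(1) d_self Vk[of k] k by auto
    then have fk1: "k < f - 1" using fk by simp
    obtain l where l: "k < l" "l \<le> f - 1" "\<And>l'. \<lbrakk>k < l'; l' \<le> f - 1\<rbrakk> \<Longrightarrow> depth l' \<le> depth l"
      using deepest_exists[OF fk1] by blast
    have ln: "l \<in> {1..n}" using l f by auto
    have lk: "l \<noteq> k" "l \<noteq> f" using l(1,2) fk1 by auto
    have IH: "d (pr l (c k)) (pr l (c (l - 1))) \<le> 2" "d (pr l (c (f - 1))) (pr l (c l)) \<le> 2"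
      using less.hyps[OF _ l(1,2) _ l(3)] less.prems t fk by auto
    show False
      using no_enclosed_side[OF f k ln, of "f - 1" k l "l - 1" "pr k (c (f - 1))"] lk j2 IH long[OF ln]
        d_sym[of "pr l (c l)"] by auto
  qed
  ultimately show ?case ..
qed

text \<open>If the ends coincide, their common projection is within 2 of both feet of the deepest
  side, which are at least 11 apart.\<close>

theorem not_closed:
  assumes "n > 0"
  shows "c 0 \<noteq> c n"
proof
  assume eq: "c 0 = c n"
  obtain k where k: "0 < k" "k \<le> n" "\<And>l. \<lbrakk>0 < l; l \<le> n\<rbrakk> \<Longrightarrow> depth l \<le> depth k"
    using deepest_exists[OF assms] by blast
  then have kn: "k \<in> {1..n}" by auto
  have V: "pr k (c t) \<in> V" if "t \<le> n" for t using gate_in_V Z_convex[OF kn] c_V that by auto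
  have "d (pr k (c 0)) (pr k (c (k - 1))) \<le> 2" "d (pr k (c 0)) (pr k (c k)) \<le> 2"
    using deepest_is_shell[of 0 k n] k eq by auto
  then show False
    using long[OF kn] d_tri[OF V[of "k - 1"] V[of 0] V[of k]] k(2) d_sym[of "pr k (c (k - 1))" "pr k (c 0)"]
    by linarith
qed

end

section \<open>The free group\<close>

definition flip :: "letter \<Rightarrow> letter" where "flip x = (fst x, \<not> snd x)"

lemma reduced_Nil [simp]: "reduced []"
  by (simp add: reduced_def)

lemma reduced_Cons:
  "reduced (x # w) \<longleftrightarrow> reduced w \<and> (w = [] \<or> hd w \<noteq> flip x)"
proof (cases w)
  case Nil
  then show ?thesis by (simp add: reduced_def)
next
  case (Cons y ys)
  have "(fst x = fst y \<and> snd x \<noteq> snd y) \<longleftrightarrow> y = flip x"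
    by (cases x; cases y) (auto simp: flip_def)
  moreover have "reduced (x # y # ys) \<longleftrightarrow> \<not> (fst x = fst y \<and> snd x \<noteq> snd y) \<and> reduced (y # ys)"
  proof
    assume r: "reduced (x # y # ys)"
    have "\<not> (fst x = fst y \<and> snd x \<noteq> snd y)"
      using r[unfolded reduced_def, rule_format, of 0] by simp
    moreover have "reduced (y # ys)"
      unfolding reduced_def using r[unfolded reduced_def, rule_format, of "Suc i" for i] by simp
    ultimately show "\<not> (fst x = fst y \<and> snd x \<noteq> snd y) \<and> reduced (y # ys)" by blast
  next
    assume r: "\<not> (fst x = fst y \<and> snd x \<noteq> snd y) \<and> reduced (y # ys)"
    show "reduced (x # y # ys)"
      unfolding reduced_def
    proof (intro allI impI)
      fix i assume i: "Suc i < length (x # y # ys)"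
      show "\<not> (fst ((x # y # ys) ! i) = fst ((x # y # ys) ! Suc i)
          \<and> snd ((x # y # ys) ! i) \<noteq> snd ((x # y # ys) ! Suc i))"
      proof (cases i)
        case 0
        then show ?thesis using r by simp
      next
        case (Suc i')
        then show ?thesis using r[THEN conjunct2, unfolded reduced_def, rule_format, of i'] i by simp
      qed
    qed
  qed
  ultimately show ?thesis using Cons by auto
qed

lemma push_eq: "push x w = (if w \<noteq> [] \<and> hd w = flip x then tl w else x # w)"
  by (cases w; cases x) (auto simp: flip_def)

lemma flip_flip [simp]: "flip (flip x) = x"
  by (simp add: flip_def)

lemma reduced_tl: "reduced w \<Longrightarrow> reduced (tl w)"
  by (cases w) (auto simp: reduced_Cons)

lemma reduced_push: "reduced w \<Longrightarrow> reduced (push x w)"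
  by (auto simp: push_eq reduced_Cons reduced_tl)

lemma push_flip_push: "reduced w \<Longrightarrow> push (flip x) (push x w) = w"
  by (cases w) (auto simp: push_eq reduced_Cons)

lemma reduced_foldr_push: "reduced w \<Longrightarrow> reduced (foldr push xs w)"
  by (induction xs) (auto intro: reduced_push)

lemma reduced_reduce: "reduced (reduce xs)"
  by (simp add: reduce_def reduced_foldr_push)

lemma reduce_reduced: "reduced w \<Longrightarrow> reduce w = w"
  unfolding reduce_def by (induction w) (auto simp: reduced_Cons push_eq)

lemma reduce_Cons: "reduce (x # xs) = push x (reduce xs)"
  by (simp add: reduce_def)

text \<open>A cancellation inside \<open>push x u\<close> is matched by two opposite pushes onto
  \<open>w\<close>. Hence a left factor acts only through its reduction, which is what associativity
  in \<open>F2\<close> requires.\<close>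

lemma foldr_push_push:
  assumes "reduced w"
  shows "foldr push (push x u) w = push x (foldr push u w)"
proof (cases "u \<noteq> [] \<and> hd u = flip x")
  case True
  then obtain u' where u: "u = flip x # u'" by (cases u) auto
  have "push x (push (flip x) (foldr push u' w)) = foldr push u' w"
    using push_flip_push[of _ "flip x"] reduced_foldr_push assms by simp
  then show ?thesis using u by (simp add: push_eq[of x u])
next
  case False
  then have "push x u = x # u" by (auto simp: push_eq)
  then show ?thesis by simp
qed

lemma foldr_push_reduce: "reduced w \<Longrightarrow> foldr push (reduce xs) w = foldr push xs w"
  by (induction xs) (auto simp: reduce_Cons foldr_push_push, simp add: reduce_def)

lemma reduce_append: "reduce (xs @ ys) = foldr push xs (reduce ys)"
  by (simp add: reduce_def)

lemma mult_F2: "x \<otimes>\<^bsub>F2\<^esub> y = reduce (x @ y)"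
  and one_F2: "\<one>\<^bsub>F2\<^esub> = []"
  and carrier_F2: "carrier F2 = {w. reduced w}"
  by (simp_all add: F2_def)

lemma reduce_reduce_left: "reduce (reduce xs @ ys) = reduce (xs @ ys)"
  by (simp add: reduce_append foldr_push_reduce reduced_reduce)

lemma reduce_reduce_right: "reduce (xs @ reduce ys) = reduce (xs @ ys)"
  by (simp add: reduce_append reduce_reduced reduced_reduce)

lemma reduce_inverse: "reduce (rev (map flip w) @ w @ v) = reduce v"
proof (induction w arbitrary: v)
  case (Cons x w)
  have "reduce (rev (map flip (x # w)) @ (x # w) @ v)
      = foldr push (rev (map flip w)) (push (flip x) (push x (reduce (w @ v))))"
    by (simp add: reduce_append reduce_Cons)
  also have "\<dots> = reduce (rev (map flip w) @ w @ v)"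
    using push_flip_push[OF reduced_foldr_push[OF reduced_reduce]] by (simp add: reduce_append)
  finally show ?case using Cons.IH by simp
qed simp

interpretation F2: group F2
proof (rule groupI)
  fix x y z assume "x \<in> carrier F2" "y \<in> carrier F2" "z \<in> carrier F2"
  then show "x \<otimes>\<^bsub>F2\<^esub> y \<otimes>\<^bsub>F2\<^esub> z = x \<otimes>\<^bsub>F2\<^esub> (y \<otimes>\<^bsub>F2\<^esub> z)"
    by (simp add: mult_F2 reduce_reduce_left reduce_reduce_right)
next
  fix x assume "x \<in> carrier F2"
  have "reduce (rev (map flip x)) \<otimes>\<^bsub>F2\<^esub> x = \<one>\<^bsub>F2\<^esub>"
    unfolding mult_F2 one_F2 reduce_reduce_left
    using reduce_inverse[of x "[]"] by (simp add: reduce_def)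
  then show "\<exists>y\<in>carrier F2. y \<otimes>\<^bsub>F2\<^esub> x = \<one>\<^bsub>F2\<^esub>"
    using reduced_reduce by (auto simp: carrier_F2)
qed (auto simp: mult_F2 one_F2 carrier_F2 reduced_reduce reduce_reduced)

lemma F2_mult_inv_cancel:
  assumes "x \<in> carrier F2" "y \<in> carrier F2"
  shows "x \<otimes>\<^bsub>F2\<^esub> (inv\<^bsub>F2\<^esub> x \<otimes>\<^bsub>F2\<^esub> y) = y" "inv\<^bsub>F2\<^esub> x \<otimes>\<^bsub>F2\<^esub> (x \<otimes>\<^bsub>F2\<^esub> y) = y"
  using assms by (simp_all flip: F2.m_assoc)

lemma F2_eq_mult_inv:
  assumes "x \<otimes>\<^bsub>F2\<^esub> y = z" "x \<in> carrier F2" "y \<in> carrier F2"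
  shows "z \<otimes>\<^bsub>F2\<^esub> inv\<^bsub>F2\<^esub> y = x"
  using assms(2,3) by (simp add: F2.m_assoc flip: assms(1))

section \<open>Powers of the generators and the alternating normal form\<close>

definition gen :: "bool \<Rightarrow> letter list" where "gen t = [(t, False)]"

definition pw :: "bool \<Rightarrow> int \<Rightarrow> letter list" where "pw t k = gen t [^]\<^bsub>F2\<^esub> k"

lemma gen_closed [simp]: "gen t \<in> carrier F2"
  by (simp add: gen_def carrier_F2 reduced_Cons)

lemma pw_closed [simp]: "pw t k \<in> carrier F2"
  by (simp add: pw_def)

lemma pw_0 [simp]: "pw t 0 = \<one>\<^bsub>F2\<^esub>"
  by (simp add: pw_def)

lemma pw_add: "pw t (j + k) = pw t j \<otimes>\<^bsub>F2\<^esub> pw t k"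
  by (simp add: pw_def F2.int_pow_mult)

lemma pw_minus: "pw t (- k) = inv\<^bsub>F2\<^esub> (pw t k)"
  by (simp add: pw_def F2.int_pow_neg)

lemma pw_letter: "pw t (if e then - 1 else 1) = [(t, e)]"
proof -
  have "[(t, True)] \<otimes>\<^bsub>F2\<^esub> gen t = \<one>\<^bsub>F2\<^esub>"
    by (simp add: gen_def mult_F2 one_F2 reduce_def)
  moreover have "[(t, True)] \<in> carrier F2" by (simp add: carrier_F2 reduced_Cons)
  ultimately have "inv\<^bsub>F2\<^esub> (gen t) = [(t, True)]"
    by (intro F2.inv_equality gen_closed)
  moreover have "pw t (-1) = inv\<^bsub>F2\<^esub> (pw t 1)" by (rule pw_minus)
  moreover have "pw t 1 = gen t" by (simp add: pw_def F2.int_pow_1)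
  ultimately show ?thesis by (simp add: gen_def)
qed

fun word :: "bool \<Rightarrow> int list \<Rightarrow> letter list" where
  "word t [] = \<one>\<^bsub>F2\<^esub>"
| "word t (k # w) = pw t k \<otimes>\<^bsub>F2\<^esub> word (\<not> t) w"

lemma word_closed [simp]: "word t w \<in> carrier F2"
  by (induction w arbitrary: t) auto

lemma pw_word_normal_form:
  assumes "0 \<notin> set w"
  shows "\<exists>r v. 0 \<notin> set v \<and> pw t j \<otimes>\<^bsub>F2\<^esub> word t' w = word r v"
proof -
  consider "j = 0" | "j \<noteq> 0" "t' \<noteq> t" | "w = []" "j \<noteq> 0" | k w' where "t' = t" "w = k # w'"
    by (cases w) auto
  then show ?thesis
  proof cases
    case 1
    then show ?thesis using assms by auto
  next
    case 2
    then show ?thesis using assms by (intro exI[of _ t] exI[of _ "j # w"]) auto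
  next
    case 3
    then show ?thesis by (intro exI[of _ t] exI[of _ "[j]"]) auto
  next
    case (4 k w')
    have *: "pw t j \<otimes>\<^bsub>F2\<^esub> word t' w = pw t (j + k) \<otimes>\<^bsub>F2\<^esub> word (\<not> t) w'"
      using 4 by (simp add: pw_add F2.m_assoc)
    show ?thesis
    proof (cases "j + k = 0")
      case True
      then show ?thesis using assms 4 * by (intro exI[of _ "\<not> t"] exI[of _ w']) auto
    next
      case False
      then show ?thesis using assms 4 * by (intro exI[of _ t] exI[of _ "(j + k) # w'"]) auto
    qed
  qed
qed

lemma normal_form:
  assumes "y \<in> carrier F2"
  obtains t w where "0 \<notin> set w" "y = word t w"
proof -
  have "reduced y \<Longrightarrow> \<exists>t w. 0 \<notin> set w \<and> y = word t w"
  proof (induction y)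
    case Nil
    then show ?case by (intro exI[of _ False] exI[of _ "[]"]) (auto simp: one_F2)
  next
    case (Cons x y)
    obtain t w where w: "0 \<notin> set w" "y = word t w"
      using Cons by (auto simp: reduced_Cons)
    have "x # y = [x] \<otimes>\<^bsub>F2\<^esub> y" using Cons.prems by (simp add: mult_F2 reduce_reduced)
    also have "[x] = pw (fst x) (if snd x then -1 else 1)" using pw_letter[of "fst x" "snd x"] by simp
    finally show ?case using pw_word_normal_form[OF w(1)] w(2) by metis
  qed
  then show thesis using assms that by (auto simp: carrier_F2)
qed

section \<open>The Bass-Serre tree of the splitting into cyclic factors\<close>

fun lcp :: "'a list \<Rightarrow> 'a list \<Rightarrow> nat" where
  "lcp (x # xs) (y # ys) = (if x = y then Suc (lcp xs ys) else 0)"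
| "lcp _ _ = 0"

lemma lcp_Nil [simp]: "lcp xs [] = 0"
  by (cases xs) auto

lemma lcp_sym: "lcp xs ys = lcp ys xs"
  by (induction xs ys rule: lcp.induct) auto

lemma lcp_le: "lcp xs ys \<le> length xs" "lcp xs ys \<le> length ys"
  by (induction xs ys rule: lcp.induct) auto

text \<open>\<open>lcp\<close> is the Gromov product based at the empty list, and this is
  0-hyperbolicity: triangle inequality, four-point condition and medians all come from it.\<close>

lemma lcp_ultra: "min (lcp xs ys) (lcp ys zs) \<le> lcp xs zs"
proof (induction xs ys arbitrary: zs rule: lcp.induct)
  case (1 x xs y ys)
  then show ?case by (cases zs) auto
qed auto

lemma lcp_self [simp]: "lcp xs xs = length xs"
  by (induction xs) auto

lemma lcp_take: "lcp (take n xs) xs = min n (length xs)"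
  by (induction xs arbitrary: n) (auto simp: take_Cons split: nat.splits)

lemma lcp_eq_length: "lcp xs ys = length xs \<Longrightarrow> xs = take (length xs) ys"
  by (induction xs ys rule: lcp.induct) (auto split: if_splits)

definition ldist :: "'a list \<Rightarrow> 'a list \<Rightarrow> nat" where
  "ldist xs ys = length xs + length ys - 2 * lcp xs ys"

lemma ldist_int: "int (ldist xs ys) = int (length xs) + int (length ys) - 2 * int (lcp xs ys)"
  using lcp_le[of xs ys] by (simp add: ldist_def)

lemma ldist_sym: "ldist xs ys = ldist ys xs"
  by (simp add: ldist_def lcp_sym)

lemma ldist_eq_0: "ldist xs ys = 0 \<longleftrightarrow> xs = ys"
proof
  assume "ldist xs ys = 0"
  then have "lcp xs ys = length xs" "length xs = length ys"
    using ldist_int[of xs ys] lcp_le[of xs ys] by auto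
  then show "xs = ys" using lcp_eq_length by fastforce
qed (simp add: ldist_def)

lemma ldist_tri: "ldist xs zs \<le> ldist xs ys + ldist ys zs"
proof -
  have "int (ldist xs zs) \<le> int (ldist xs ys) + int (ldist ys zs)"
    unfolding ldist_int using lcp_ultra[of xs ys zs] lcp_le[of xs ys] lcp_le[of ys zs] by linarith
  then show ?thesis by simp
qed

lemma ldist_four_point:
  "ldist x y + ldist z w \<le> max (ldist x z + ldist y w) (ldist x w + ldist y z)"
proof -
  have "lcp x y + lcp z w \<ge> min (lcp x z + lcp y w) (lcp x w + lcp y z)"
    using lcp_ultra[of x z y] lcp_ultra[of x w y] lcp_ultra[of z x w] lcp_ultra[of z y w]
      lcp_sym[of z x] lcp_sym[of z y] lcp_sym[of w y]
    by (auto simp: min_def split: if_splits)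
  then have "int (ldist x y) + int (ldist z w)
      \<le> max (int (ldist x z) + int (ldist y w)) (int (ldist x w) + int (ldist y z))"
    unfolding ldist_int by linarith
  then show ?thesis by linarith
qed

text \<open>For the pair with the longest common prefix the other two values of \<open>lcp\<close>
  agree, so that prefix is the branching point of the tripod.\<close>

lemma ldist_take_median:
  assumes "lcp x z \<le> lcp x y" "lcp y z \<le> lcp x y"
  defines "m \<equiv> take (lcp x y) x"
  shows "ldist x y = ldist x m + ldist m y" "ldist x z = ldist x m + ldist m z"
    "ldist y z = ldist y m + ldist m z"
proof -
  have lm: "length m = lcp x y" using lcp_le[of x y] by (simp add: m_def)
  have xm: "lcp m x = lcp x y" using lcp_take[of "lcp x y" x] lcp_le[of x y] by (simp add: m_def)
  have ym: "lcp m y = lcp x y"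
    using lcp_ultra[of m x y] xm lm lcp_le[of m y] by linarith
  have zm: "lcp m z = lcp x z"
    using lcp_ultra[of m x z] lcp_ultra[of x m z] xm assms(1) lm lcp_le[of m z] lcp_sym[of x m] by linarith
  have yz: "lcp y z = lcp x z"
    using lcp_ultra[of y x z] lcp_ultra[of x y z] assms(1,2) lcp_sym[of x y] by linarith
  have "int (ldist x y) = int (ldist x m) + int (ldist m y)"
    "int (ldist x z) = int (ldist x m) + int (ldist m z)"
    "int (ldist y z) = int (ldist y m) + int (ldist m z)"
    unfolding ldist_int using lm xm ym zm yz lcp_sym[of x m] lcp_sym[of y m] by simp_all
  then show "ldist x y = ldist x m + ldist m y" "ldist x z = ldist x m + ldist m z"
    "ldist y z = ldist y m + ldist m z" by linarith+
qed

text \<open>The median is exhibited as a prefix of one of the three lists because admissible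
  coordinates, those without a 0 after the head, are closed under prefixes.\<close>

lemma ldist_median:
  "\<exists>m n v. v \<in> {x, y, z} \<and> m = take n v \<and>
    ldist x y = ldist x m + ldist m y \<and> ldist x z = ldist x m + ldist m z \<and>
    ldist y z = ldist y m + ldist m z"
proof -
  consider "lcp x z \<le> lcp x y" "lcp y z \<le> lcp x y" | "lcp x y \<le> lcp x z" "lcp y z \<le> lcp x z"
    | "lcp x y \<le> lcp y z" "lcp x z \<le> lcp y z" by linarith
  then show ?thesis
  proof cases
    case 1
    then show ?thesis using ldist_take_median[of x z y] by blast
  next
    case 2
    let ?m = "take (lcp x z) x"
    have "ldist x y = ldist x ?m + ldist ?m y" "ldist x z = ldist x ?m + ldist ?m z"
      "ldist z y = ldist z ?m + ldist ?m y"
      using ldist_take_median[of x y z] 2 lcp_sym[of y z] by linarith+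
    moreover have "ldist y z = ldist z y" "ldist y ?m = ldist ?m y" "ldist ?m z = ldist z ?m"
      by (rule ldist_sym)+
    ultimately have "ldist x y = ldist x ?m + ldist ?m y \<and> ldist x z = ldist x ?m + ldist ?m z \<and>
      ldist y z = ldist y ?m + ldist ?m z" by linarith
    then show ?thesis by blast
  next
    case 3
    let ?m = "take (lcp y z) y"
    have "ldist y x = ldist y ?m + ldist ?m x" "ldist y z = ldist y ?m + ldist ?m z"
      "ldist z x = ldist z ?m + ldist ?m x"
      using ldist_take_median[of y x z] 3 lcp_sym[of x y] lcp_sym[of x z] by linarith+
    moreover have "ldist y x = ldist x y" "ldist z x = ldist x z" "ldist y ?m = ldist ?m y" "ldist ?m x = ldist x ?m" "ldist z ?m = ldist ?m z"
      by (rule ldist_sym)+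
    ultimately have "ldist x y = ldist x ?m + ldist ?m y \<and> ldist x z = ldist x ?m + ldist ?m z \<and>
      ldist y z = ldist y ?m + ldist ?m z" by linarith
    then show ?thesis by blast
  qed
qed

text \<open>This reduces convexity to closure under prefixes.\<close>

lemma ldist_between:
  assumes "ldist x y = ldist x u + ldist u y"
  shows "u = take (length u) x \<or> u = take (length u) y"
proof -
  have "int (length u) = int (lcp x u) + int (lcp u y) - int (lcp x y)"
    using assms ldist_int[of x y] ldist_int[of x u] ldist_int[of u y] by linarith
  then have "length u \<le> max (lcp u x) (lcp u y)"
    using lcp_ultra[of x u y] lcp_sym[of x u] by linarith
  then have "lcp u x = length u \<or> lcp u y = length u"
    using lcp_le(1)[of u x] lcp_le(1)[of u y] by linarith
  then show ?thesis using lcp_eq_length by blast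
qed

type_synonym vertex = "bool \<times> int list"

text \<open>The vertex \<open>(t, [k1, ..., kr])\<close> is reached from the edge between the two cyclic factors by
  the alternating syllables \<open>k1, ..., kr\<close>, the first of which is a power of the generator \<open>t\<close>;
  so \<open>(t, [])\<close> is the vertex fixed by that generator. The coordinate \<open>co t\<close> is the path to a
  vertex in the tree rooted at \<open>(t, [])\<close>.\<close>

definition verts :: "vertex set" where "verts = {v. 0 \<notin> set (snd v)}"

definition co :: "bool \<Rightarrow> vertex \<Rightarrow> int list" where
  "co t v = (if fst v = t then snd v else 0 # snd v)"

definition dec :: "bool \<Rightarrow> int list \<Rightarrow> vertex" where
  "dec t u = (case u of [] \<Rightarrow> (t, []) | k # w \<Rightarrow> if k = 0 then (\<not> t, w) else (t, u))"

definition vdist :: "vertex \<Rightarrow> vertex \<Rightarrow> nat" where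
  "vdist v w = ldist (co False v) (co False w)"

lemma co_dec [simp]: "co t (dec t u) = u"
  by (auto simp: co_def dec_def split: list.split)

lemma dec_co [simp]: "v \<in> verts \<Longrightarrow> dec t (co t v) = v"
  by (cases v) (auto simp: co_def dec_def verts_def split: list.split)

lemma dec_verts: "0 \<notin> set (tl u) \<Longrightarrow> dec t u \<in> verts"
  by (auto simp: dec_def verts_def split: list.split)

lemma set_tl_co: "v \<in> verts \<Longrightarrow> 0 \<notin> set (tl (co t v))"
  by (cases v; cases "snd v") (auto simp: co_def verts_def)

text \<open>Changing the root adds or removes a leading 0. For vertices of equal type this changes
  both lengths and the common prefix by 1; for different types exactly one list starts with 0, so
  the common prefix stays empty.\<close>

lemma vdist_co: "\<lbrakk>v \<in> verts; w \<in> verts\<rbrakk> \<Longrightarrow> vdist v w = ldist (co t v) (co t w)"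
  by (cases v; cases w; cases "snd v"; cases "snd w"; cases t)
    (auto simp: vdist_def co_def verts_def ldist_def)

interpretation tree: tree_metric verts vdist
proof
  fix x y z w :: vertex
  show "vdist x y = vdist y x" by (simp add: vdist_def ldist_sym)
  show "vdist x z \<le> vdist x y + vdist y z" by (simp add: vdist_def ldist_tri)
  show "vdist x y + vdist z w \<le> max (vdist x z + vdist y w) (vdist x w + vdist y z)"
    by (simp add: vdist_def ldist_four_point)
  assume V: "x \<in> verts" "y \<in> verts"
  show "vdist x y = 0 \<longleftrightarrow> x = y"
    using V dec_co[of x False] dec_co[of y False] unfolding vdist_def ldist_eq_0 by metis
  assume z: "z \<in> verts"
  obtain m n v where v: "v \<in> {co False x, co False y, co False z}" and m: "m = take n v"
    and eq: "ldist (co False x) (co False y) = ldist (co False x) m + ldist m (co False y)"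
      "ldist (co False x) (co False z) = ldist (co False x) m + ldist m (co False z)"
      "ldist (co False y) (co False z) = ldist (co False y) m + ldist m (co False z)"
    using ldist_median by metis
  have "0 \<notin> set (tl v)" using v set_tl_co[OF V(1)] set_tl_co[OF V(2)] set_tl_co[OF z] by auto
  then have "0 \<notin> set (tl m)" using m set_take_subset by (cases v; cases n) fastforce+
  then show "\<exists>m\<in>verts. vdist x y = vdist x m + vdist m y \<and> vdist x z = vdist x m + vdist m z
      \<and> vdist y z = vdist y m + vdist m z"
    using eq by (intro bexI[of _ "dec False m"]) (auto simp: vdist_def dec_verts)
qed

section \<open>The action of the free group on the tree\<close>

fun add_hd :: "int \<Rightarrow> int list \<Rightarrow> int list" where
  "add_hd k [] = []"
| "add_hd k (j # w) = (j + k) # w"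

text \<open>In the coordinate \<open>co t\<close> the edges at \<open>(t, [])\<close> are indexed by
  all integers, 0 being the edge to the other base vertex. A power of the generator \<open>t\<close>
  therefore acts as a plain translation of the head, without cases for syllables that appear or
  vanish.\<close>

definition sh :: "bool \<Rightarrow> int \<Rightarrow> vertex \<Rightarrow> vertex" where
  "sh t k v = dec t (add_hd k (co t v))"

lemma ldist_add_hd [simp]: "ldist (add_hd k u) (add_hd k v) = ldist u v"
  by (cases u; cases v) (auto simp: ldist_def)

lemma tl_add_hd [simp]: "tl (add_hd k u) = tl u"
  by (cases u) auto

lemma add_hd_add [simp]: "add_hd j (add_hd k u) = add_hd (j + k) u"
  by (cases u) auto

lemma add_hd_0 [simp]: "add_hd 0 u = u"
  by (cases u) auto

lemma sh_verts: "v \<in> verts \<Longrightarrow> sh t k v \<in> verts"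
  by (simp add: sh_def dec_verts set_tl_co)

lemma vdist_sh: "\<lbrakk>v \<in> verts; w \<in> verts\<rbrakk> \<Longrightarrow> vdist (sh t k v) (sh t k w) = vdist v w"
  using vdist_co[of "sh t k v" "sh t k w" t] vdist_co[of v w t] sh_verts by (simp add: sh_def)

lemma sh_sh: "sh t j (sh t k v) = sh t (j + k) v"
  by (simp add: sh_def)

lemma sh_0: "v \<in> verts \<Longrightarrow> sh t 0 v = v"
  by (simp add: sh_def)

definition act_letter :: "letter \<Rightarrow> vertex \<Rightarrow> vertex" where
  "act_letter x = sh (fst x) (if snd x then -1 else 1)"

definition act :: "letter list \<Rightarrow> vertex \<Rightarrow> vertex" where
  "act w v = foldr act_letter w v"

lemma act_verts [simp]: "v \<in> verts \<Longrightarrow> act w v \<in> verts"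
  by (induction w) (auto simp: act_def act_letter_def sh_verts)

lemma vdist_act: "\<lbrakk>v \<in> verts; v' \<in> verts\<rbrakk> \<Longrightarrow> vdist (act w v) (act w v') = vdist v v'"
proof (induction w)
  case (Cons x w)
  then show ?case
    using vdist_sh[OF act_verts[of v w] act_verts[of v' w]] by (simp add: act_def act_letter_def)
qed (simp add: act_def)

lemma act_push: "v \<in> verts \<Longrightarrow> act (push x w) v = act_letter x (act w v)"
proof (cases "w \<noteq> [] \<and> hd w = flip x")
  case True
  assume v: "v \<in> verts"
  obtain w' where w: "w = flip x # w'" using True by (cases w) auto
  have "act_letter x (act_letter (flip x) (act w' v)) = act w' v"
    using act_verts[OF v] by (simp add: act_letter_def sh_sh flip_def sh_0)
  then show ?thesis using w by (simp add: push_eq act_def)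
qed (auto simp: push_eq act_def)

lemma act_reduce: "v \<in> verts \<Longrightarrow> act (reduce w) v = act w v"
  by (induction w) (simp add: reduce_def, simp add: reduce_Cons act_push, simp add: act_def)

lemma act_mult: "v \<in> verts \<Longrightarrow> act (x \<otimes>\<^bsub>F2\<^esub> y) v = act x (act y v)"
  by (simp add: mult_F2 act_reduce) (simp add: act_def)

lemma act_one [simp]: "act \<one>\<^bsub>F2\<^esub> v = v"
  by (simp add: act_def one_F2)

lemma act_inv_act [simp]:
  assumes "x \<in> carrier F2" "v \<in> verts"
  shows "act (inv\<^bsub>F2\<^esub> x) (act x v) = v" "act x (act (inv\<^bsub>F2\<^esub> x) v) = v"
  using assms act_mult[of v "inv\<^bsub>F2\<^esub> x" x] act_mult[of v x "inv\<^bsub>F2\<^esub> x"] by simp_all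

lemma act_pw_nat: "v \<in> verts \<Longrightarrow> act (pw t (int n)) v = sh t (int n) v"
proof (induction n)
  case 0
  then show ?case by (simp add: sh_0)
next
  case (Suc n)
  have "pw t (int (Suc n)) = pw t 1 \<otimes>\<^bsub>F2\<^esub> pw t (int n)" by (simp flip: pw_add)
  moreover have "pw t 1 = [(t, False)]" using pw_letter[of t False] by simp
  ultimately show ?case using Suc by (simp add: act_mult) (simp add: act_def act_letter_def sh_sh)
qed

lemma act_pw: "v \<in> verts \<Longrightarrow> act (pw t k) v = sh t k v"
proof (cases k)
  case (neg n)
  assume v: "v \<in> verts"
  let ?n = "int (Suc n)"
  have "act (pw t k) v = act (pw t k) (act (pw t ?n) (sh t k v))"
    using act_pw_nat[OF sh_verts[OF v]] neg v by (simp add: sh_sh sh_0 del: of_nat_Suc)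
  also have "\<dots> = sh t k v" using neg pw_minus[of t ?n] sh_verts[OF v] by simp
  finally show ?thesis .
qed (simp add: act_pw_nat)

lemma sh_simps:
  "sh t k (t, []) = (t, [])"
  "sh t k (\<not> t, w) = (if k = 0 then (\<not> t, w) else (t, k # w))"
  "sh t k (t, j # w) = (if j + k = 0 then (\<not> t, w) else (t, (j + k) # w))"
  by (auto simp: sh_def co_def dec_def)

text \<open>Together with \<open>act_word_start\<close>: the word carries the base edge to the edge
  joining \<open>(t, w)\<close> and its predecessor. The base vertex fixed by the last syllable goes
  to the predecessor, and the parity of the length tells which one that is.\<close>

lemma act_word_end:
  "0 \<notin> set w \<Longrightarrow> act (word t w) (if even (length w) then t else \<not> t, []) = (t, w)"
proof (induction w arbitrary: t)
  case (Cons k w)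
  have "(if even (length (k # w)) then t else \<not> t, []) \<in> verts"
    "(if even (length w) then \<not> t else \<not> \<not> t, []) \<in> verts" by (auto simp: verts_def)
  moreover have "(\<not> t, w) \<in> verts" using Cons.prems by (auto simp: verts_def)
  ultimately show ?case
    using Cons.IH[of "\<not> t"] Cons.prems by (auto simp: act_mult act_pw sh_simps split: if_splits)
qed auto

lemma act_word_start:
  "0 \<notin> set w \<Longrightarrow> act (word t w) (if even (length w) then \<not> t else t, [])
     = (if w = [] then (\<not> t, []) else (t, butlast w))"
proof (induction w arbitrary: t)
  case (Cons k w)
  have "(if even (length (k # w)) then \<not> t else t, []) \<in> verts" by (auto simp: verts_def)
  moreover have "(t, []) \<in> verts" "(\<not> t, butlast w) \<in> verts"
    using Cons.prems by (auto simp: verts_def dest: in_set_butlastD)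
  ultimately show ?case
    using Cons.IH[of "\<not> t"] Cons.prems by (auto simp: act_mult act_pw sh_simps split: if_splits)
qed auto

lemma vdist_root: "v \<in> verts \<Longrightarrow> vdist (t, []) v = length (co t v)"
  using vdist_co[of "(t, [])" v t] by (simp add: verts_def co_def ldist_def)

section \<open>Subtrees read by an automaton\<close>

text \<open>The states are the edges of a finite graph immersed in the quotient of the tree; \<open>node t e\<close> is the
  end of type \<open>t\<close> of the edge \<open>e\<close>, and turning from \<open>e\<close> to \<open>f\<close> at a common end of type \<open>t\<close> reads
  the power \<open>off t f - off t e\<close> of the generator \<open>t\<close>. The element \<open>u e\<close> is read along
  some path from the base edge to \<open>e\<close>, and \<open>C\<close> is the group of labels of closed paths.\<close>

locale automaton =
  fixes E :: "'e set" and node :: "bool \<Rightarrow> 'e \<Rightarrow> 'n" and off :: "bool \<Rightarrow> 'e \<Rightarrow> int"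
    and e0 :: 'e and u :: "'e \<Rightarrow> letter list" and C :: "letter list set"
  assumes off_inj: "\<lbrakk>e \<in> E; f \<in> E; node t e = node t f; off t e = off t f\<rbrakk> \<Longrightarrow> e = f"
    and turn_unique: "\<lbrakk>e \<in> E; f \<in> E; e' \<in> E; f' \<in> E; node t e = node t f; node t e' = node t f';
      off t f - off t e = off t f' - off t e'; e \<noteq> f\<rbrakk> \<Longrightarrow> e = e'"
    and turn_exists: "e \<in> E \<Longrightarrow> \<exists>t. \<exists>f\<in>E. f \<noteq> e \<and> node t f = node t e"
    and e0_E: "e0 \<in> E"
    and C_subgroup: "subgroup C F2"
    and u_closed: "e \<in> E \<Longrightarrow> u e \<in> carrier F2"
    and u_e0: "u e0 = \<one>\<^bsub>F2\<^esub>"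
    and u_turn: "\<lbrakk>e \<in> E; f \<in> E; node t e = node t f\<rbrakk> \<Longrightarrow>
      u e \<otimes>\<^bsub>F2\<^esub> pw t (off t f - off t e) \<otimes>\<^bsub>F2\<^esub> inv\<^bsub>F2\<^esub> (u f) \<in> C"
begin

fun run :: "'e \<Rightarrow> bool \<Rightarrow> int list \<Rightarrow> 'e \<Rightarrow> bool" where
  "run e t [] f \<longleftrightarrow> e = f"
| "run e t (k # w) f \<longleftrightarrow> (\<exists>e'\<in>E. node t e' = node t e \<and> off t e' = off t e + k \<and> run e' (\<not> t) w f)"

text \<open>The development of the graph in the tree with the state \<open>e\<close> placed on the
  base edge; \<open>sub e0\<close> is the subtree Y of the overview.\<close>

definition sub :: "'e \<Rightarrow> vertex set" where
  "sub e = {v \<in> verts. \<exists>f. run e (fst v) (snd v) f}"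

lemma run_E: "\<lbrakk>run e t w f; e \<in> E\<rbrakk> \<Longrightarrow> f \<in> E"
  by (induction w arbitrary: e t) auto

lemma run_take: "run e t w f \<Longrightarrow> \<exists>f'. run e t (take n w) f'"
proof (induction w arbitrary: e t n)
  case (Cons k w)
  show ?case
  proof (cases n)
    case 0
    have "run e t [] e" by simp
    then show ?thesis using 0 by (metis take_0)
  next
    case (Suc n')
    obtain e' where e': "e' \<in> E" "node t e' = node t e" "off t e' = off t e + k" "run e' (\<not> t) w f"
      using Cons.prems by auto
    obtain f' where "run e' (\<not> t) (take n' w) f'" using Cons.IH[OF e'(4)] by blast
    then have "run e t (take n (k # w)) f'" using e' Suc by auto
    then show ?thesis by blast
  qed
next
  case Nil
  then show ?case by (metis take_Nil)
qed

section \<open>Convexity and change of base edge of the subtrees\<close>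

lemma sub_verts: "sub e \<subseteq> verts"
  by (auto simp: sub_def)

lemma root_sub: "(t, []) \<in> sub e"
proof -
  have "run e t [] e" by simp
  then show ?thesis unfolding sub_def verts_def by fastforce
qed

lemma sub_prefix:
  assumes "v \<in> sub e"
  shows "dec False (take n (co False v)) \<in> sub e"
proof (cases "fst v")
  case False
  have nz: "0 \<notin> set (take n (snd v))" using assms by (auto simp: sub_def verts_def dest: in_set_takeD)
  then have "dec False (take n (co False v)) = (False, take n (snd v))"
    using False by (auto simp: co_def dec_def split: list.split)
  moreover have "(False, take n (snd v)) \<in> sub e"
    using assms False run_take[of e False "snd v" _ n] nz by (auto simp: sub_def verts_def)
  ultimately show ?thesis by simp
next
  case True
  show ?thesis
  proof (cases n)
    case 0
    then show ?thesis using root_sub by (simp add: dec_def)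
  next
    case (Suc n')
    have "dec False (take n (co False v)) = (True, take n' (snd v))"
      using True Suc by (simp add: co_def dec_def)
    moreover have "(True, take n' (snd v)) \<in> sub e"
      using assms True run_take[of e True "snd v" _ n'] by (auto simp: sub_def verts_def dest: in_set_takeD)
    ultimately show ?thesis by simp
  qed
qed

lemma sub_convex: "tree.convex (sub e)"
  unfolding tree.convex_def
proof (intro conjI ballI impI)
  show "sub e \<noteq> {}" using root_sub by blast
  fix x y v assume xy: "x \<in> sub e" "y \<in> sub e" and v: "v \<in> verts"
    and eq: "vdist x y = vdist x v + vdist v y"
  then consider n where "co False v = take n (co False x)" | n where "co False v = take n (co False y)"
    using ldist_between unfolding vdist_def by metis
  then show "v \<in> sub e"
    using sub_prefix xy dec_co[OF v, of False] by cases metis+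
qed (rule sub_verts)

lemma act_convex:
  assumes x: "x \<in> carrier F2" and Z: "tree.convex Z"
  shows "tree.convex (act x ` Z)"
  unfolding tree.convex_def
proof (intro conjI ballI impI)
  have ZV: "Z \<subseteq> verts" and "Z \<noteq> {}" using Z unfolding tree.convex_def by blast+
  then show "act x ` Z \<subseteq> verts" "act x ` Z \<noteq> {}" by auto
  fix p q v assume p: "p \<in> act x ` Z" and q: "q \<in> act x ` Z" and v: "v \<in> verts"
    and eq: "vdist p q = vdist p v + vdist v q"
  obtain p' q' where p': "p' \<in> Z" "p = act x p'" and q': "q' \<in> Z" "q = act x q'" using p q by auto
  let ?v = "act (inv\<^bsub>F2\<^esub> x) v"
  have V: "p' \<in> verts" "q' \<in> verts" "?v \<in> verts" using p' q' ZV v by auto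
  have vx: "v = act x ?v" using x v by simp
  have "vdist p' q' = vdist p' ?v + vdist ?v q'"
    using eq vdist_act[OF V(1,2), of x] vdist_act[OF V(1,3), of x] vdist_act[OF V(3,2), of x] p' q' vx
    by metis
  then have "?v \<in> Z" using Z p' q' V unfolding tree.convex_def by blast
  then show "v \<in> act x ` Z" using vx by blast
qed

lemma image_act_mult: "Z \<subseteq> verts \<Longrightarrow> act (x \<otimes>\<^bsub>F2\<^esub> y) ` Z = act x ` act y ` Z"
  by (force simp: act_mult image_iff subset_eq)

lemma image_act_inv:
  assumes "x \<in> carrier F2" "Z \<subseteq> verts"
  shows "act (inv\<^bsub>F2\<^esub> x) ` act x ` Z = Z" "act x ` act (inv\<^bsub>F2\<^esub> x) ` Z = Z"
  using assms by (simp_all flip: image_act_mult)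

lemma sh_sub:
  assumes e: "e \<in> E" and f: "f \<in> E" and n: "node t e = node t f"
    and v: "v \<in> sub f"
  shows "sh t (off t f - off t e) v \<in> sub e"
proof -
  let ?k = "off t f - off t e"
  obtain r w where rw: "v = (r, w)" by force
  have vV: "v \<in> verts" and wV: "0 \<notin> set w" using v rw by (auto simp: sub_def verts_def)
  obtain g where g: "run f r w g" using v rw by (auto simp: sub_def)
  have sV: "sh t ?k v \<in> verts" using sh_verts vV by blast
  show ?thesis
  proof (cases "r = t")
    case False
    then have r: "r = (\<not> t)" by simp
    show ?thesis
    proof (cases "?k = 0")
      case True
      then have "e = f" using off_inj[OF e f n] by simp
      then show ?thesis using v sh_0[OF vV] by simp
    next
      case False
      have "run e t (?k # w) g" using g r f n by auto
      then show ?thesis using False r rw sV by (auto simp: sub_def sh_simps)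
    qed
  next
    case True
    show ?thesis
    proof (cases w)
      case Nil
      then show ?thesis using True rw root_sub by (simp add: sh_simps)
    next
      case (Cons j w')
      then obtain f' where f': "f' \<in> E" "node t f' = node t f" "off t f' = off t f + j" "run f' (\<not> t) w' g"
        using g True by auto
      show ?thesis
      proof (cases "j + ?k = 0")
        case z: True
        \<comment> \<open>The first syllable cancels, so the path returns to the base edge of the
          new development; \<open>off_inj\<close> confirms that the state reached there is
          \<open>e\<close>.\<close>
        then have "off t f' = off t e" using f' by simp
        then have "f' = e" using off_inj[OF f'(1) e, of t] f' n by simp
        then show ?thesis using z f' rw True Cons sV by (auto simp: sub_def sh_simps)
      next
        case nz: False
        have "run e t ((j + ?k) # w') g" using f' n by auto
        then show ?thesis using nz rw True Cons sV by (auto simp: sub_def sh_simps)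
      qed
    qed
  qed
qed

lemma pw_sub:
  assumes e: "e \<in> E" and f: "f \<in> E" and n: "node t e = node t f"
  shows "act (pw t (off t f - off t e)) ` sub f = sub e"
proof -
  let ?k = "off t f - off t e"
  have "act (pw t ?k) v \<in> sub e" if "v \<in> sub f" for v
    using sh_sub[OF e f n that] act_pw[of v t ?k] that sub_verts[of f] by auto
  moreover have "v \<in> act (pw t ?k) ` sub f" if v: "v \<in> sub e" for v
  proof -
    have vV: "v \<in> verts" using v sub_verts by blast
    have "sh t (- ?k) v \<in> sub f" using sh_sub[OF f e n[symmetric] v] by simp
    moreover have "act (pw t ?k) (sh t (- ?k) v) = v"
      using act_pw[OF sh_verts[OF vV]] sh_0[OF vV] by (simp add: sh_sh)
    ultimately show ?thesis by (metis imageI)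
  qed
  ultimately show ?thesis by blast
qed

lemma C_closed: "x \<in> C \<Longrightarrow> x \<in> carrier F2"
  using subgroup.mem_carrier[OF C_subgroup] .

lemma C_mult: "\<lbrakk>x \<in> C; y \<in> C\<rbrakk> \<Longrightarrow> x \<otimes>\<^bsub>F2\<^esub> y \<in> C"
  using subgroup.m_closed[OF C_subgroup] .

lemma C_inv: "x \<in> C \<Longrightarrow> inv\<^bsub>F2\<^esub> x \<in> C"
  using subgroup.m_inv_closed[OF C_subgroup] .

lemma C_chain:
  assumes "x \<otimes>\<^bsub>F2\<^esub> inv\<^bsub>F2\<^esub> y \<in> C" "y \<otimes>\<^bsub>F2\<^esub> z \<in> C"
    and "x \<in> carrier F2" "y \<in> carrier F2" "z \<in> carrier F2"
  shows "x \<otimes>\<^bsub>F2\<^esub> z \<in> C"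
proof -
  have "(x \<otimes>\<^bsub>F2\<^esub> inv\<^bsub>F2\<^esub> y) \<otimes>\<^bsub>F2\<^esub> (y \<otimes>\<^bsub>F2\<^esub> z) = x \<otimes>\<^bsub>F2\<^esub> z"
    using assms(3-) F2_mult_inv_cancel by (simp add: F2.m_assoc)
  then show ?thesis using C_mult[OF assms(1,2)] by simp
qed

text \<open>Compose the one-syllable changes of base edge. The second part says that modulo
  \<open>C\<close> a label depends only on the ends of the run; as \<open>u e0\<close> is trivial,
  closed runs at \<open>e0\<close> have labels in \<open>C\<close>.\<close>

lemma run_word:
  assumes "run e t w f" "e \<in> E"
  shows "act (word t w) ` sub f = sub e"
    and "u e \<otimes>\<^bsub>F2\<^esub> word t w \<otimes>\<^bsub>F2\<^esub> inv\<^bsub>F2\<^esub> (u f) \<in> C"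
proof -
  have "act (word t w) ` sub f = sub e \<and> u e \<otimes>\<^bsub>F2\<^esub> word t w \<otimes>\<^bsub>F2\<^esub> inv\<^bsub>F2\<^esub> (u f) \<in> C"
    using assms
  proof (induction w arbitrary: e t)
    case Nil
    then show ?case using u_closed[of e] subgroup.one_closed[OF C_subgroup] by simp
  next
    case (Cons k w)
    then obtain e' where e': "e' \<in> E" "node t e' = node t e" "off t e' = off t e + k" "run e' (\<not> t) w f"
      by auto
    have IH: "act (word (\<not> t) w) ` sub f = sub e'"
      "u e' \<otimes>\<^bsub>F2\<^esub> word (\<not> t) w \<otimes>\<^bsub>F2\<^esub> inv\<^bsub>F2\<^esub> (u f) \<in> C"
      using Cons.IH[OF e'(4,1)] by auto
    have fE: "f \<in> E" using run_E[OF e'(4,1)] .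
    have cl: "u e \<in> carrier F2" "u e' \<in> carrier F2" "u f \<in> carrier F2"
      using u_closed Cons.prems(2) e'(1) fE by auto
    have k: "off t e' - off t e = k" using e' by simp
    have "act (pw t k) ` sub e' = sub e" using pw_sub[OF Cons.prems(2) e'(1) e'(2)[symmetric]] k by simp
    moreover have "u e \<otimes>\<^bsub>F2\<^esub> pw t k \<otimes>\<^bsub>F2\<^esub> inv\<^bsub>F2\<^esub> (u e') \<in> C"
      using u_turn[OF Cons.prems(2) e'(1) e'(2)[symmetric]] k by simp
    ultimately show ?case
      using IH C_chain[of "u e \<otimes>\<^bsub>F2\<^esub> pw t k" "u e'" "word (\<not> t) w \<otimes>\<^bsub>F2\<^esub> inv\<^bsub>F2\<^esub> (u f)"] cl
        image_act_mult[OF sub_verts, of "pw t k" "word (\<not> t) w" f]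
      by (simp add: F2.m_assoc)
  qed
  then show "act (word t w) ` sub f = sub e"
    and "u e \<otimes>\<^bsub>F2\<^esub> word t w \<otimes>\<^bsub>F2\<^esub> inv\<^bsub>F2\<^esub> (u f) \<in> C" by blast+
qed

lemma sub_inj:
  assumes e: "e \<in> E" and f: "f \<in> E" and k: "k \<noteq> 0" "(t, [k]) \<in> sub e" "(t, [k]) \<in> sub f"
  shows "e = f"
proof -
  obtain e' where e': "e' \<in> E" "node t e' = node t e" "off t e' = off t e + k"
    using k(2) by (auto simp: sub_def)
  obtain f' where f': "f' \<in> E" "node t f' = node t f" "off t f' = off t f + k"
    using k(3) by (auto simp: sub_def)
  have "e \<noteq> e'" using e'(3) k(1) by auto
  moreover have "off t e' - off t e = off t f' - off t f" using e'(3) f'(3) by simp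
  \<comment> \<open>The power \<open>k\<close> read when turning away from the base edge determines
    the state on it. In this form condition (A) makes translates rigid.\<close>
  ultimately show ?thesis
    using turn_unique[OF e e'(1) f f'(1) e'(2)[symmetric] f'(2)[symmetric]] by blast
qed

lemma sub_eq_iff:
  assumes e: "e \<in> E" and f: "f \<in> E" and eq: "sub e = sub f"
  shows "e = f"
proof -
  obtain t e' where e': "e' \<in> E" "e' \<noteq> e" "node t e' = node t e" using turn_exists[OF e] by blast
  let ?k = "off t e' - off t e"
  have nz: "?k \<noteq> 0" using off_inj[OF e'(1) e e'(3)] e'(2) by auto
  have "(t, [?k]) \<in> sub e" using e' nz by (auto simp: sub_def verts_def)
  then show ?thesis using sub_inj[OF e f nz] eq by simp
qed

text \<open>By \<open>act_word_end\<close> one of the images of the two base vertices is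
  \<open>(r, w)\<close>, where \<open>w\<close> lists the syllables of \<open>y\<close>, and
  membership in \<open>sub e\<close> means precisely that they can be read from
  \<open>e\<close>.\<close>

lemma edge_in_translate:
  assumes e: "e \<in> E" and y: "y \<in> carrier F2"
    and F: "act y (False, []) \<in> sub e" and T: "act y (True, []) \<in> sub e"
  obtains r w f where "0 \<notin> set w" "y = word r w" "run e r w f"
proof -
  obtain r w where w: "0 \<notin> set w" "y = word r w" using normal_form[OF y] .
  have "(r, w) \<in> sub e"
    using act_word_end[OF w(1), of r] F T w(2) by (cases "even (length w)"; cases r) simp_all
  then show thesis using that w by (auto simp: sub_def)
qed

text \<open>Recentring: moving \<open>v\<close> to a base vertex and an adjacent edge of the
  translate to the base edge turns questions about arbitrary translates into questions about some
  \<open>sub f\<close>.\<close>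

lemma translate_at_vertex:
  assumes x: "x \<in> carrier F2" and v: "v \<in> act (inv\<^bsub>F2\<^esub> x) ` sub e0"
  obtains g f t where "g \<in> carrier F2" "f \<in> E" "act g (t, []) = v"
    "act (inv\<^bsub>F2\<^esub> x) ` sub e0 = act g ` sub f" "x \<otimes>\<^bsub>F2\<^esub> g \<otimes>\<^bsub>F2\<^esub> inv\<^bsub>F2\<^esub> (u f) \<in> C"
proof -
  obtain r w where rw: "(r, w) \<in> sub e0" "v = act (inv\<^bsub>F2\<^esub> x) (r, w)" using v by force
  then obtain f where f: "run e0 r w f" and w: "0 \<notin> set w" by (auto simp: sub_def verts_def)
  let ?g = "inv\<^bsub>F2\<^esub> x \<otimes>\<^bsub>F2\<^esub> word r w"
  have fE: "f \<in> E" using run_E[OF f e0_E] .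
  have "act ?g (if even (length w) then r else \<not> r, []) = v"
    using act_word_end[OF w] rw(2) by (simp add: act_mult verts_def)
  moreover have "act (inv\<^bsub>F2\<^esub> x) ` sub e0 = act ?g ` sub f"
    using run_word(1)[OF f e0_E] image_act_mult[OF sub_verts] by simp
  moreover have "x \<otimes>\<^bsub>F2\<^esub> ?g \<otimes>\<^bsub>F2\<^esub> inv\<^bsub>F2\<^esub> (u f) \<in> C"
    using run_word(2)[OF f e0_E] x by (simp add: u_e0 F2_mult_inv_cancel)
  ultimately show thesis using that[of ?g f] x fE by auto
qed

lemma C_cancel:
  assumes "x \<otimes>\<^bsub>F2\<^esub> z \<in> C" "y \<otimes>\<^bsub>F2\<^esub> z \<in> C"
    and "x \<in> carrier F2" "y \<in> carrier F2" "z \<in> carrier F2"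
  shows "x \<otimes>\<^bsub>F2\<^esub> inv\<^bsub>F2\<^esub> y \<in> C"
proof -
  have "(x \<otimes>\<^bsub>F2\<^esub> z) \<otimes>\<^bsub>F2\<^esub> inv\<^bsub>F2\<^esub> (y \<otimes>\<^bsub>F2\<^esub> z) = x \<otimes>\<^bsub>F2\<^esub> inv\<^bsub>F2\<^esub> y"
    using assms(3-) F2_mult_inv_cancel by (simp add: F2.m_assoc F2.inv_mult_group)
  then show ?thesis using C_mult[OF assms(1) C_inv[OF assms(2)]] by simp
qed

lemma shared_turn:
  assumes f: "f \<in> E" and y: "y \<in> carrier F2" and W: "W = act (inv\<^bsub>F2\<^esub> y) ` sub e0"
    and roots: "\<And>t. (t, []) \<in> W" and k: "k \<noteq> 0" "(r, [k]) \<in> W" "(r, [k]) \<in> sub f"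
  shows "y \<otimes>\<^bsub>F2\<^esub> inv\<^bsub>F2\<^esub> (u f) \<in> C"
proof -
  have pull: "act y v \<in> sub e0" if "v \<in> W" for v
    using that y sub_verts[of e0] unfolding W by auto
  obtain r' w f' where w: "y = word r' w" "run e0 r' w f'"
    using edge_in_translate[OF e0_E y pull[OF roots] pull[OF roots]] by metis
  have f'E: "f' \<in> E" using run_E[OF w(2) e0_E] .
  have "W = sub f'"
    using run_word(1)[OF w(2) e0_E] w(1) W image_act_inv(1)[OF y sub_verts] by metis
  then have "f' = f" using sub_inj[OF f'E f k(1)] k by simp
  then show ?thesis using run_word(2)[OF w(2) e0_E] w(1) y by (simp add: u_e0)
qed

text \<open>A path of length 2 contains a turn, to which \<open>shared_turn\<close> applies. If the
  path starts along the base edge, the turn leaves that edge at its other end. Otherwise the turn is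
  at \<open>(t, [k])\<close>, and translation by a power of the generator \<open>t\<close> first
  moves it to the base edge.\<close>

lemma shared_segment:
  assumes f: "f \<in> E" and y: "y \<in> carrier F2" and W: "W = act (inv\<^bsub>F2\<^esub> y) ` sub e0"
    and t: "(t, []) \<in> W" and v: "v \<in> W" "v \<in> sub f" "vdist (t, []) v \<ge> 2"
  shows "y \<otimes>\<^bsub>F2\<^esub> inv\<^bsub>F2\<^esub> (u f) \<in> C"
proof -
  have cW: "tree.convex W" unfolding W using act_convex[OF _ sub_convex] y by simp
  have vV: "v \<in> verts" using v sub_verts by blast
  obtain r w where rw: "v = (r, w)" by force
  have w0: "0 \<notin> set w" using vV rw by (simp add: verts_def)
  have tV: "(t, []) \<in> verts" by (simp add: verts_def)
  \<comment> \<open>The prefixes of the coordinate of \<open>v\<close> run through the geodesic from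
    \<open>(t, [])\<close> to \<open>v\<close>, which both convex sets contain.\<close>
  have pre: "dec t (take n (co t v)) \<in> W \<inter> sub f" for n
  proof -
    let ?p = "dec t (take n (co t v))"
    have pV: "?p \<in> verts"
      using set_tl_co[OF vV, of t] by (intro dec_verts) (auto simp: tl_take dest: in_set_takeD)
    have "vdist ?p v + length (take n (co t v)) = length (co t v)"
      using vdist_co[OF pV vV, of t] lcp_take[of n "co t v"] by (simp add: ldist_def)
    then have "vdist (t, []) v = vdist (t, []) ?p + vdist ?p v"
      using vdist_root[OF pV, of t] vdist_root[OF vV, of t] by simp
    then show ?thesis
      using cW sub_convex[of f] t v root_sub[of t f] pV unfolding tree.convex_def by blast
  qed
  show ?thesis
  proof (cases "r = t")
    case False
    then have r: "r = (\<not> t)" by simp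
    have cow: "co t v = 0 # w" using r rw by (auto simp: co_def)
    obtain k w' where w: "w = k # w'"
      using v(3) vdist_root[OF vV, of t] cow by (cases w) auto
    have k: "k \<noteq> 0" using w w0 by auto
    have "(\<not> t, []) \<in> W \<inter> sub f" "(\<not> t, [k]) \<in> W \<inter> sub f"
      using pre[of 1] pre[of 2] cow w by (simp_all add: dec_def)
    moreover have "(s, []) \<in> W" for s using t calculation(1) by (cases "s = t") auto
    ultimately show ?thesis using shared_turn[OF f y W _ k] by blast
  next
    case True
    have cow: "co t v = w" using True rw by (auto simp: co_def)
    obtain k l w' where w: "w = k # l # w'"
      using v(3) vdist_root[OF vV, of t] cow by (cases w; cases "tl w") auto
    have k: "k \<noteq> 0" "l \<noteq> 0" using w w0 by auto
    have tk: "(t, [k]) \<in> W \<inter> sub f" "(t, [k, l]) \<in> W \<inter> sub f"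
      using pre[of 1] pre[of 2] cow w k by (simp_all add: dec_def)
    obtain f1 where f1: "f1 \<in> E" "node t f1 = node t f" "off t f1 = off t f + k"
      using tk(1) by (auto simp: sub_def)
    let ?p = "pw t k" and ?y = "y \<otimes>\<^bsub>F2\<^esub> pw t k"
    let ?W = "act (inv\<^bsub>F2\<^esub> ?y) ` sub e0"
    have k1: "off t f1 - off t f = k" using f1 by simp
    have yV: "act (inv\<^bsub>F2\<^esub> y) ` sub e0 \<subseteq> verts" using sub_verts[of e0] by auto
    have "?W = act (inv\<^bsub>F2\<^esub> ?p) ` W"
      using image_act_mult[OF sub_verts, of "inv\<^bsub>F2\<^esub> ?p" "inv\<^bsub>F2\<^esub> y" e0] y W by (simp add: F2.inv_mult_group)
    then have shW: "sh t (- k) z \<in> ?W" if "z \<in> W" for z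
      using that yV W act_pw[of z t "- k"] pw_minus[of t k] by (metis imageI subsetD)
    have "(t, []) \<in> ?W" using shW[OF t] by (simp add: sh_simps)
    moreover have "(\<not> t, []) \<in> ?W" "(\<not> t, [l]) \<in> ?W"
      using shW[of "(t, [k])"] shW[of "(t, [k, l])"] tk by (simp_all add: sh_simps)
    moreover have "(s, []) \<in> ?W" for s using calculation by (cases "s = t") auto
    moreover have "(\<not> t, [l]) \<in> sub f1"
      using sh_sub[OF f1(1) f f1(2), of "(t, [k, l])"] tk(2) f1(3) by (simp add: sh_simps)
    ultimately have "?y \<otimes>\<^bsub>F2\<^esub> inv\<^bsub>F2\<^esub> (u f1) \<in> C"
      using shared_turn[OF f1(1) _ refl, of ?y l "\<not> t"] y k by simp
    moreover have "u f \<otimes>\<^bsub>F2\<^esub> ?p \<otimes>\<^bsub>F2\<^esub> inv\<^bsub>F2\<^esub> (u f1) \<in> C"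
      using u_turn[OF f f1(1) f1(2)[symmetric]] k1 by simp
    ultimately show ?thesis
      using C_cancel[of y "?p \<otimes>\<^bsub>F2\<^esub> inv\<^bsub>F2\<^esub> (u f1)" "u f"] y u_closed[OF f] u_closed[OF f1(1)]
      by (simp add: F2.m_assoc)
  qed
qed

lemma translates_meet_in_edge:
  assumes x: "x \<in> carrier F2" and y: "y \<in> carrier F2"
    and v: "v \<in> act (inv\<^bsub>F2\<^esub> x) ` sub e0" "v \<in> act (inv\<^bsub>F2\<^esub> y) ` sub e0"
    and w: "w \<in> act (inv\<^bsub>F2\<^esub> x) ` sub e0" "w \<in> act (inv\<^bsub>F2\<^esub> y) ` sub e0"
    and far: "vdist v w \<ge> 2"
  shows "y \<otimes>\<^bsub>F2\<^esub> inv\<^bsub>F2\<^esub> x \<in> C"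
proof -
  obtain g f t where g: "g \<in> carrier F2" "f \<in> E" "act g (t, []) = v"
    "act (inv\<^bsub>F2\<^esub> x) ` sub e0 = act g ` sub f" "x \<otimes>\<^bsub>F2\<^esub> g \<otimes>\<^bsub>F2\<^esub> inv\<^bsub>F2\<^esub> (u f) \<in> C"
    using translate_at_vertex[OF x v(1)] .
  let ?y = "y \<otimes>\<^bsub>F2\<^esub> g" and ?w = "act (inv\<^bsub>F2\<^esub> g) w"
  have tV: "(t, []) \<in> verts" by (simp add: verts_def)
  have wV: "w \<in> verts" "v \<in> verts" using w v sub_verts[of e0] by auto
  have W: "act (inv\<^bsub>F2\<^esub> ?y) ` sub e0 = act (inv\<^bsub>F2\<^esub> g) ` act (inv\<^bsub>F2\<^esub> y) ` sub e0"
    using y g(1) image_act_mult[OF sub_verts, of "inv\<^bsub>F2\<^esub> g" "inv\<^bsub>F2\<^esub> y" e0] by (simp add: F2.inv_mult_group)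
  have "(t, []) = act (inv\<^bsub>F2\<^esub> g) v" using g(1,3) tV by auto
  then have 1: "(t, []) \<in> act (inv\<^bsub>F2\<^esub> ?y) ` sub e0" using W v(2) by blast
  have 2: "?w \<in> act (inv\<^bsub>F2\<^esub> ?y) ` sub e0" using W w(2) by blast
  have 3: "?w \<in> sub f" using w(1) g(1,4) image_act_inv(1)[OF g(1) sub_verts[of f]] by blast
  have "vdist (t, []) ?w = vdist v w"
    using vdist_act[OF wV(2,1), of "inv\<^bsub>F2\<^esub> g"] \<open>(t, []) = _\<close> by simp
  then have "?y \<otimes>\<^bsub>F2\<^esub> inv\<^bsub>F2\<^esub> (u f) \<in> C"
    using shared_segment[OF g(2) _ refl 1 2 3] far y g(1) by simp
  then show ?thesis
    using C_cancel[of y "g \<otimes>\<^bsub>F2\<^esub> inv\<^bsub>F2\<^esub> (u f)" x] g u_closed[OF g(2)] x y by (simp add: F2.m_assoc)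
qed

text \<open>After recentring at \<open>v\<close>, the element \<open>c\<close> becomes the label of
  a run from \<open>f\<close> to a state with the same development, hence of a closed run, which is
  nonempty because \<open>c\<close> is not trivial.\<close>

lemma loop_moves_far:
  assumes long: "\<And>e t w. \<lbrakk>e \<in> E; run e t w e; w \<noteq> []; 0 \<notin> set w\<rbrakk> \<Longrightarrow> length w \<ge> N + 1"
    and stab: "act c ` sub e0 = sub e0" and c: "c \<in> carrier F2" "c \<noteq> \<one>\<^bsub>F2\<^esub>" and v: "v \<in> sub e0"
  shows "vdist v (act c v) \<ge> N"
proof -
  have "v \<in> act (inv\<^bsub>F2\<^esub> \<one>\<^bsub>F2\<^esub>) ` sub e0" using v by (simp add: image_def)
  then obtain g f t where g: "g \<in> carrier F2" "f \<in> E" "act g (t, []) = v"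
    "act (inv\<^bsub>F2\<^esub> \<one>\<^bsub>F2\<^esub>) ` sub e0 = act g ` sub f"
    using translate_at_vertex[OF F2.one_closed] by metis
  have g4: "act g ` sub f = sub e0" using g(4) by (simp add: image_def)
  let ?y = "inv\<^bsub>F2\<^esub> g \<otimes>\<^bsub>F2\<^esub> c \<otimes>\<^bsub>F2\<^esub> g"
  have yc: "?y \<in> carrier F2" using g c by simp
  have ys: "act ?y ` sub f = sub f"
    using image_act_mult[OF sub_verts, of "inv\<^bsub>F2\<^esub> g \<otimes>\<^bsub>F2\<^esub> c" g f] image_act_mult[OF sub_verts, of "inv\<^bsub>F2\<^esub> g" c e0]
      g4 stab image_act_inv(1)[OF g(1) sub_verts[of f]] by simp
  have "act ?y (s, []) \<in> sub f" for s using ys root_sub[of s f] by blast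
  then obtain r w f' where w: "0 \<notin> set w" "?y = word r w" "run f r w f'"
    using edge_in_translate[OF g(2) yc] by metis
  have f'E: "f' \<in> E" using run_E[OF w(3) g(2)] .
  have "act ?y ` sub f' = sub f" using run_word(1)[OF w(3) g(2)] w(2) by simp
  then have "sub f' = sub f" using ys image_act_inv(1)[OF yc sub_verts] by metis
  then have ff: "f' = f" using sub_eq_iff f'E g(2) by blast
  have "w \<noteq> []"
  proof
    assume "w = []"
    then have "inv\<^bsub>F2\<^esub> g \<otimes>\<^bsub>F2\<^esub> c \<otimes>\<^bsub>F2\<^esub> g = \<one>\<^bsub>F2\<^esub>" using w(2) by simp
    then have "g \<otimes>\<^bsub>F2\<^esub> (inv\<^bsub>F2\<^esub> g \<otimes>\<^bsub>F2\<^esub> c \<otimes>\<^bsub>F2\<^esub> g) = g" using g(1) by simp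
    then have "c \<otimes>\<^bsub>F2\<^esub> g = g" using g(1) c(1) F2_mult_inv_cancel by (simp add: F2.m_assoc)
    then have "c = \<one>\<^bsub>F2\<^esub>" using g(1) c(1) by (metis F2.r_cancel_one')
    then show False using c(2) by simp
  qed
  then have len: "length w \<ge> N + 1" using long[OF g(2)] w ff by blast
  have tV: "(t, []) \<in> verts" by (simp add: verts_def)
  \<comment> \<open>If the last syllable fixes \<open>(t, [])\<close>, the image is the end with the
    shorter list. This lost syllable is the reason for \<open>N + 1\<close> in the
    hypothesis.\<close>
  have end': "act ?y (t, []) \<in> {(r, w), (r, butlast w)}"
    using act_word_end[OF w(1), of r] act_word_start[OF w(1), of r] w(2) \<open>w \<noteq> []\<close>
    by (cases "even (length w)"; cases "r = t"; cases r; cases t) auto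
  have "vdist (t, []) (act ?y (t, [])) \<ge> N"
  proof -
    have V: "(r, w) \<in> verts" "(r, butlast w) \<in> verts"
      using w(1) by (auto simp: verts_def dest: in_set_butlastD)
    show ?thesis
      using end' vdist_root[OF V(1), of t] vdist_root[OF V(2), of t] len by (auto simp: co_def)
  qed
  moreover have "act g (act ?y (t, [])) = act c v"
    using tV g c v sub_verts[of e0] by (auto simp: act_mult)
  ultimately show ?thesis
    using vdist_act[OF tV act_verts[OF tV], of g ?y] g(3) by simp
qed

end

section \<open>Products of conjugates\<close>

locale rigid_automaton = automaton E node off e0 u C
  for E :: "'e set" and node :: "bool \<Rightarrow> 'e \<Rightarrow> 'n" and off :: "bool \<Rightarrow> 'e \<Rightarrow> int"
    and e0 :: 'e and u :: "'e \<Rightarrow> letter list" and C :: "letter list set" +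
  assumes C_stab: "c \<in> C \<Longrightarrow> act c ` sub e0 = sub e0"
    and closed_run_long: "\<lbrakk>e \<in> E; run e t w e; w \<noteq> []; 0 \<notin> set w\<rbrakk> \<Longrightarrow> length w \<ge> 12"
begin

text \<open>The translate preserved by the conjugates \<open>el (a, c)\<close> with \<open>c\<close>
  in \<open>C\<close>; the inverse appears because conjugation is from the right. It depends only on
  the coset of \<open>a\<close> modulo \<open>C\<close> on the left.\<close>

definition tr :: "letter list \<Rightarrow> vertex set" where
  "tr a = act (inv\<^bsub>F2\<^esub> a) ` sub e0"

definition el :: "letter list \<times> letter list \<Rightarrow> letter list" where
  "el p = conjg F2 (snd p) (fst p)"

definition prodl :: "(letter list \<times> letter list) list \<Rightarrow> letter list" where
  "prodl F = listprod F2 (map el F)"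

definition base :: vertex where "base = (False, [])"

definition height :: "letter list \<Rightarrow> nat" where
  "height a = tree.setdist (tr a) base"

definition valid :: "(letter list \<times> letter list) list \<Rightarrow> bool" where
  "valid F \<longleftrightarrow> (\<forall>p\<in>set F. fst p \<in> carrier F2 \<and> snd p \<in> C \<and> snd p \<noteq> \<one>\<^bsub>F2\<^esub>)"

lemma base_verts [simp]: "base \<in> verts"
  by (simp add: base_def verts_def)

lemma tr_verts: "tr a \<subseteq> verts"
  using sub_verts[of e0] by (auto simp: tr_def)

lemma tr_convex: "a \<in> carrier F2 \<Longrightarrow> tree.convex (tr a)"
  by (simp add: tr_def act_convex sub_convex)

lemma act_tr:
  assumes "a \<in> carrier F2" "y \<in> carrier F2"
  shows "act y ` tr a = tr (a \<otimes>\<^bsub>F2\<^esub> inv\<^bsub>F2\<^esub> y)"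
  using assms image_act_mult[OF sub_verts, of y "inv\<^bsub>F2\<^esub> a" e0] by (simp add: tr_def F2.inv_mult_group)

lemma tr_C:
  assumes "a \<in> carrier F2" "c \<in> C"
  shows "tr (c \<otimes>\<^bsub>F2\<^esub> a) = tr a"
  using assms C_closed[of c] C_stab[OF C_inv] image_act_mult[OF sub_verts, of "inv\<^bsub>F2\<^esub> a" "inv\<^bsub>F2\<^esub> c" e0]
  by (simp add: tr_def F2.inv_mult_group)

lemma gate_act:
  assumes Z: "tree.convex Z" and v: "v \<in> verts" and y: "y \<in> carrier F2"
  shows "tree.gate (act y ` Z) (act y v) = act y (tree.gate Z v)"
proof (rule tree.gate_eqI[OF act_convex[OF y Z]])
  show "act y (tree.gate Z v) \<in> act y ` Z" using tree.gate_props(1)[OF Z v] by blast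
  fix z assume "z \<in> act y ` Z"
  then obtain z' where z': "z' \<in> Z" "z = act y z'" by blast
  have V: "z' \<in> verts" "tree.gate Z v \<in> verts"
    using z' tree.convex_subset[OF Z] tree.gate_in_V[OF Z v] by auto
  show "vdist (act y v) z = vdist (act y v) (act y (tree.gate Z v)) + vdist (act y (tree.gate Z v)) z"
    using tree.gate_props(2)[OF Z v z'(1)] vdist_act V v z'(2) by simp
qed (simp add: v)

lemma setdist_act:
  assumes Z: "tree.convex Z" and v: "v \<in> verts" and y: "y \<in> carrier F2"
  shows "tree.setdist (act y ` Z) (act y v) = tree.setdist Z v"
  using gate_act[OF assms] vdist_act[OF v tree.gate_in_V[OF Z v]] by (simp add: tree.setdist_def)

text \<open>The bridge between the two pictures: replacing \<open>a\<close> by the product of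
  \<open>a\<close> and \<open>y\<close> conjugates the factor by \<open>y\<close>, so heights after
  Hurwitz moves are distances from images of \<open>base\<close> to translates.\<close>

lemma setdist_tr:
  assumes "a \<in> carrier F2" "y \<in> carrier F2"
  shows "tree.setdist (tr a) (act y base) = height (a \<otimes>\<^bsub>F2\<^esub> y)"
  using setdist_act[OF tr_convex[OF assms(1)] act_verts[OF base_verts], of "inv\<^bsub>F2\<^esub> y" y]
    act_tr[of a "inv\<^bsub>F2\<^esub> y"] assms by (simp add: height_def)

lemma height_C: "\<lbrakk>a \<in> carrier F2; c \<in> C\<rbrakk> \<Longrightarrow> height (c \<otimes>\<^bsub>F2\<^esub> a) = height a"
  by (simp add: height_def tr_C)

lemma el_eq: "el (a, c) = inv\<^bsub>F2\<^esub> a \<otimes>\<^bsub>F2\<^esub> c \<otimes>\<^bsub>F2\<^esub> a"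
  by (simp add: el_def conjg_def)

lemma el_closed: "\<lbrakk>a \<in> carrier F2; c \<in> C\<rbrakk> \<Longrightarrow> el (a, c) \<in> carrier F2"
  using C_closed by (simp add: el_eq)

lemma mult_el: "\<lbrakk>a \<in> carrier F2; c \<in> C\<rbrakk> \<Longrightarrow> a \<otimes>\<^bsub>F2\<^esub> el (a, c) = c \<otimes>\<^bsub>F2\<^esub> a"
  using C_closed[of c] F2_mult_inv_cancel by (simp add: el_eq F2.m_assoc)

lemma el_mult:
  assumes "a \<in> carrier F2" "c \<in> C" "y \<in> carrier F2"
  shows "el (a \<otimes>\<^bsub>F2\<^esub> y, c) = inv\<^bsub>F2\<^esub> y \<otimes>\<^bsub>F2\<^esub> el (a, c) \<otimes>\<^bsub>F2\<^esub> y"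
  using assms C_closed[of c] by (simp add: el_eq F2.m_assoc F2.inv_mult_group)

lemma prodl_Nil [simp]: "prodl [] = \<one>\<^bsub>F2\<^esub>"
  by (simp add: prodl_def listprod_def)

lemma prodl_Cons [simp]: "prodl (p # F) = el p \<otimes>\<^bsub>F2\<^esub> prodl F"
  by (simp add: prodl_def listprod_def)

lemma valid_simps [simp]:
  "valid []"
  "valid (p # F) \<longleftrightarrow> fst p \<in> carrier F2 \<and> snd p \<in> C \<and> snd p \<noteq> \<one>\<^bsub>F2\<^esub> \<and> valid F"
  "valid (F @ G) \<longleftrightarrow> valid F \<and> valid G"
  by (auto simp: valid_def)

lemma el_closed': "\<lbrakk>fst p \<in> carrier F2; snd p \<in> C\<rbrakk> \<Longrightarrow> el p \<in> carrier F2"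
  using el_closed[of "fst p" "snd p"] by simp

lemma prodl_closed: "valid F \<Longrightarrow> prodl F \<in> carrier F2"
  by (induction F) (auto simp: el_closed')

lemma prodl_append: "\<lbrakk>valid F; valid G\<rbrakk> \<Longrightarrow> prodl (F @ G) = prodl F \<otimes>\<^bsub>F2\<^esub> prodl G"
  by (induction F) (auto simp: prodl_closed el_closed' F2.m_assoc)

section \<open>The polygon of a product of conjugates\<close>

lemma thin_translates:
  assumes x: "x \<in> carrier F2" and y: "y \<in> carrier F2" and ne: "x \<otimes>\<^bsub>F2\<^esub> inv\<^bsub>F2\<^esub> y \<notin> C"
    and vw: "v \<in> tr y" "w \<in> tr y"
  shows "vdist (tree.gate (tr x) v) (tree.gate (tr x) w) \<le> 1"
proof (rule ccontr)
  let ?g = "tree.gate (tr x) v" and ?h = "tree.gate (tr x) w"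
  assume far: "\<not> ?thesis"
  have V: "v \<in> verts" "w \<in> verts" using vw tr_verts by blast+
  have "?g \<noteq> ?h"
    using far tree.d_self[OF tree.gate_in_V[OF tr_convex[OF x] V(2)]] by auto
  then have "?g \<in> tr y" "?h \<in> tr y"
    using tree.gate_mem_of_gates_distinct[OF tr_convex[OF x] tr_convex[OF y]] vw by metis+
  moreover have "?g \<in> tr x" "?h \<in> tr x"
    using tree.gate_props(1)[OF tr_convex[OF x]] V by auto
  ultimately show False
    using translates_meet_in_edge[OF y x, of ?g ?h] far ne unfolding tr_def by auto
qed

lemma el_moves_far:
  assumes a: "a \<in> carrier F2" and c: "c \<in> C" "c \<noteq> \<one>\<^bsub>F2\<^esub>" and v: "v \<in> tr a"
  shows "vdist v (act (el (a, c)) v) \<ge> 11"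
proof -
  obtain v' where v': "v' \<in> sub e0" "v = act (inv\<^bsub>F2\<^esub> a) v'" using v by (auto simp: tr_def)
  have V: "v' \<in> verts" using v' sub_verts by blast
  have cc: "c \<in> carrier F2" using C_closed c by blast
  have "act (el (a, c)) v = act (inv\<^bsub>F2\<^esub> a) (act c v')"
    using v' V a cc by (simp add: el_eq act_mult)
  then have "vdist v (act (el (a, c)) v) = vdist v' (act c v')"
    using v'(2) vdist_act[OF V act_verts[OF V]] by simp
  then show ?thesis
    using loop_moves_far[of 11, OF _ C_stab[OF c(1)] cc c(2) v'(1)] closed_run_long by simp
qed

text \<open>The vertices are the images of \<open>base\<close> under the partial products
  \<open>P i\<close>, and side \<open>j\<close> follows the image of \<open>tr (a j)\<close> under
  \<open>P (j - 1)\<close>, which is \<open>tr (b j)\<close>. A trivial product would close the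
  polygon, against \<open>not_closed\<close>.\<close>

lemma prodl_ne_one:
  assumes F: "valid F" "F \<noteq> []"
    and left: "\<And>A B p R. F = A @ B @ p # R \<Longrightarrow> height (fst p) \<le> height (fst p \<otimes>\<^bsub>F2\<^esub> inv\<^bsub>F2\<^esub> (prodl B))"
    and right: "\<And>A B p R. F = A @ p # B @ R \<Longrightarrow> height (fst p) \<le> height (fst p \<otimes>\<^bsub>F2\<^esub> prodl B)"
    and distinct: "\<And>A B p q R. F = A @ p # B @ q # R \<Longrightarrow>
      fst q \<otimes>\<^bsub>F2\<^esub> inv\<^bsub>F2\<^esub> (prodl B) \<otimes>\<^bsub>F2\<^esub> inv\<^bsub>F2\<^esub> (fst p) \<notin> C"
  shows "prodl F \<noteq> \<one>\<^bsub>F2\<^esub>"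
proof
  assume one: "prodl F = \<one>\<^bsub>F2\<^esub>"
  define n where "n = length F"
  define P where "P i = prodl (take i F)" for i
  define a where "a j = fst (F ! (j - 1))" for j
  define x where "x j = el (F ! (j - 1))" for j
  define b where "b j = a j \<otimes>\<^bsub>F2\<^esub> inv\<^bsub>F2\<^esub> (P (j - 1))" for j
  define c where "c i = act (P i) base" for i
  have vt: "valid (take i F)" "valid (drop i F)" for i
    using F(1) append_take_drop_id[of i F] valid_simps(3) by metis+
  have Pc: "P i \<in> carrier F2" for i using prodl_closed[OF vt(1)] by (simp add: P_def)
  have ac: "a j \<in> carrier F2" "snd (F ! (j - 1)) \<in> C" "snd (F ! (j - 1)) \<noteq> \<one>\<^bsub>F2\<^esub>" if "j \<in> {1..n}" for j
    using F(1) nth_mem[of "j - 1" F] that by (auto simp: valid_def a_def n_def)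
  have Fj: "F ! (j - 1) = (a j, snd (F ! (j - 1)))" for j by (simp add: a_def)
  have xc: "x j \<in> carrier F2" if "j \<in> {1..n}" for j
    using el_closed[OF ac(1,2)[OF that]] by (simp add: x_def a_def)
  have bc: "b j \<in> carrier F2" if "j \<in> {1..n}" for j using ac(1)[OF that] Pc by (simp add: b_def)
  have split: "F = take i F @ take (j - i) (drop i F) @ drop j F" if "i \<le> j" "j \<le> n" for i j
  proof -
    have "take (j - i) (drop i F) @ drop j F = drop i F"
      using append_take_drop_id[of "j - i" "drop i F"] that by simp
    then show ?thesis by simp
  qed
  have Psplit: "P j = P i \<otimes>\<^bsub>F2\<^esub> prodl (take (j - i) (drop i F))" if "i \<le> j" for i j
  proof -
    have "take j F = take i F @ take (j - i) (drop i F)" using that by (metis le_add_diff_inverse take_add)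
    then show ?thesis
      using prodl_append[of "take i F" "take (j - i) (drop i F)"] vt(1)[of j] by (simp add: P_def)
  qed
  have dropj: "drop (j - 1) F = F ! (j - 1) # drop j F" if "j \<in> {1..n}" for j
  proof -
    have "j - 1 < length F" "Suc (j - 1) = j" using that by (auto simp: n_def)
    then show ?thesis using Cons_nth_drop_Suc[of "j - 1" F] by simp
  qed
  have Pstep: "P j = P (j - 1) \<otimes>\<^bsub>F2\<^esub> x j" if "j \<in> {1..n}" for j
    using Psplit[of "j - 1" j] dropj[OF that] that xc[OF that] by (simp add: x_def)
  have ax: "a j \<otimes>\<^bsub>F2\<^esub> x j = snd (F ! (j - 1)) \<otimes>\<^bsub>F2\<^esub> a j" if "j \<in> {1..n}" for j
    using mult_el[OF ac(1,2)[OF that]] by (simp add: x_def a_def)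
  have bP: "b j \<otimes>\<^bsub>F2\<^esub> P (j - 1) = a j" "b j \<otimes>\<^bsub>F2\<^esub> P j = snd (F ! (j - 1)) \<otimes>\<^bsub>F2\<^esub> a j"
    if "j \<in> {1..n}" for j
    using ac(1)[OF that] Pc xc[OF that] ax[OF that] Pstep[OF that] F2_mult_inv_cancel
    by (simp_all add: b_def F2.m_assoc)
  \<comment> \<open>The block \<open>?B\<close> consists of the factors between vertex
    \<open>i\<close> and side \<open>j\<close>: for \<open>i < j\<close> the factor moves left past
    it, otherwise right.\<close>
  have near: "height (a j) \<le> height (b j \<otimes>\<^bsub>F2\<^esub> P i)" if j: "j \<in> {1..n}" and i: "i \<le> n" for i j
  proof (cases "i < j")
    case True
    let ?B = "take (j - 1 - i) (drop i F)"
    have Bc: "prodl ?B \<in> carrier F2" using prodl_closed vt(2)[of i] append_take_drop_id valid_simps(3) by metis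
    have "F = take i F @ ?B @ F ! (j - 1) # drop j F"
      using split[of i "j - 1"] True j dropj[OF j] by auto
    then have "height (a j) \<le> height (a j \<otimes>\<^bsub>F2\<^esub> inv\<^bsub>F2\<^esub> (prodl ?B))"
      using left by (simp add: a_def)
    moreover have "b j \<otimes>\<^bsub>F2\<^esub> P i = a j \<otimes>\<^bsub>F2\<^esub> inv\<^bsub>F2\<^esub> (prodl ?B)"
      using Psplit[of i "j - 1"] True Bc Pc[of i] ac(1)[OF j]
      by (simp add: b_def F2.m_assoc F2.inv_mult_group)
    ultimately show ?thesis by simp
  next
    case False
    let ?B = "take (i - j) (drop j F)"
    have Bc: "prodl ?B \<in> carrier F2" using prodl_closed vt(2)[of j] append_take_drop_id valid_simps(3) by metis
    have "F = take (j - 1) F @ drop (j - 1) F" by simp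
    also have "drop (j - 1) F = F ! (j - 1) # ?B @ drop i F"
      using dropj[OF j] append_take_drop_id[of "i - j" "drop j F"] False by simp
    finally have "height (a j) \<le> height (a j \<otimes>\<^bsub>F2\<^esub> prodl ?B)"
      using right by (simp add: a_def)
    \<comment> \<open>To the right of side \<open>j\<close> the vertex also involves factor
      \<open>j\<close> itself, which contributes an element of \<open>C\<close> on the left and
      leaves the height unchanged.\<close>
    also have "\<dots> = height (snd (F ! (j - 1)) \<otimes>\<^bsub>F2\<^esub> (a j \<otimes>\<^bsub>F2\<^esub> prodl ?B))"
      using height_C ac(1,2)[OF j] Bc by simp
    also have "snd (F ! (j - 1)) \<otimes>\<^bsub>F2\<^esub> (a j \<otimes>\<^bsub>F2\<^esub> prodl ?B) = b j \<otimes>\<^bsub>F2\<^esub> P i"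
      using Psplit[of j i] False bP(2)[OF j] Bc Pc[of j] bc[OF j] ac(1,2)[OF j] C_closed
      by (simp flip: F2.m_assoc)
    finally show ?thesis .
  qed
  have depth: "tree.setdist (tr (b j)) (c i) = height (b j \<otimes>\<^bsub>F2\<^esub> P i)" if "j \<in> {1..n}" for i j
    using setdist_tr[OF bc[OF that] Pc] by (simp add: c_def)
  have own: "height (b j \<otimes>\<^bsub>F2\<^esub> P (j - 1)) = height (a j)" "height (b j \<otimes>\<^bsub>F2\<^esub> P j) = height (a j)"
    if "j \<in> {1..n}" for j
    using bP[OF that] height_C ac(1,2)[OF that] by simp_all
  have sep: "b k \<otimes>\<^bsub>F2\<^esub> inv\<^bsub>F2\<^esub> (b j) \<notin> C" if j: "j \<in> {1..n}" and k: "k \<in> {1..n}" and jk: "j < k" for j k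
  proof
    assume bb: "b k \<otimes>\<^bsub>F2\<^esub> inv\<^bsub>F2\<^esub> (b j) \<in> C"
    let ?B = "take (k - 1 - j) (drop j F)"
    have Bc: "prodl ?B \<in> carrier F2" using prodl_closed vt(2)[of j] append_take_drop_id valid_simps(3) by metis
    have "F = take (j - 1) F @ drop (j - 1) F" by simp
    also have "drop (j - 1) F = F ! (j - 1) # drop j F" using dropj[OF j] .
    also have "drop j F = ?B @ drop (k - 1) F"
      using append_take_drop_id[of "k - 1 - j" "drop j F"] jk by simp
    also have "drop (k - 1) F = F ! (k - 1) # drop k F" using dropj[OF k] .
    finally have no: "a k \<otimes>\<^bsub>F2\<^esub> inv\<^bsub>F2\<^esub> (prodl ?B) \<otimes>\<^bsub>F2\<^esub> inv\<^bsub>F2\<^esub> (a j) \<notin> C"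
      using distinct by (simp add: a_def)
    have "b j \<otimes>\<^bsub>F2\<^esub> P j = snd (F ! (j - 1)) \<otimes>\<^bsub>F2\<^esub> a j" using bP(2)[OF j] .
    then have "b j = snd (F ! (j - 1)) \<otimes>\<^bsub>F2\<^esub> a j \<otimes>\<^bsub>F2\<^esub> inv\<^bsub>F2\<^esub> (P j)"
      using F2_eq_mult_inv[OF _ bc[OF j] Pc] by metis
    moreover have "b k = a k \<otimes>\<^bsub>F2\<^esub> inv\<^bsub>F2\<^esub> (prodl ?B) \<otimes>\<^bsub>F2\<^esub> inv\<^bsub>F2\<^esub> (P j)"
      using Psplit[of j "k - 1"] jk Bc Pc[of j] ac(1)[OF k] by (simp add: b_def F2.m_assoc F2.inv_mult_group)
    ultimately have "b k \<otimes>\<^bsub>F2\<^esub> inv\<^bsub>F2\<^esub> (b j)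
        = a k \<otimes>\<^bsub>F2\<^esub> inv\<^bsub>F2\<^esub> (prodl ?B) \<otimes>\<^bsub>F2\<^esub> inv\<^bsub>F2\<^esub> (a j) \<otimes>\<^bsub>F2\<^esub> inv\<^bsub>F2\<^esub> (snd (F ! (j - 1)))"
      using Bc Pc[of j] ac(1)[OF k] ac(1,2)[OF j] C_closed F2_mult_inv_cancel
      by (simp add: F2.m_assoc F2.inv_mult_group)
    then have "b k \<otimes>\<^bsub>F2\<^esub> inv\<^bsub>F2\<^esub> (b j) \<otimes>\<^bsub>F2\<^esub> snd (F ! (j - 1))
        = a k \<otimes>\<^bsub>F2\<^esub> inv\<^bsub>F2\<^esub> (prodl ?B) \<otimes>\<^bsub>F2\<^esub> inv\<^bsub>F2\<^esub> (a j)"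
      using Bc ac(1)[OF k] ac(1,2)[OF j] C_closed by (simp add: F2.m_assoc)
    then show False using C_mult[OF bb ac(2)[OF j]] no by simp
  qed
  interpret polygon verts vdist n c "\<lambda>j. tr (b j)"
  proof
    fix i assume "i \<le> n" then show "c i \<in> verts" by (simp add: c_def)
  next
    fix j assume j: "j \<in> {1..n}"
    show "tree.convex (tr (b j))" using tr_convex bc[OF j] by simp
    let ?g = "tree.gate (tr (b j)) (c (j - 1))"
    have cV: "c (j - 1) \<in> verts" by (simp add: c_def)
    \<comment> \<open>This element takes \<open>c (j - 1)\<close> to \<open>c j\<close> and is a
      nontrivial element of the stabiliser of the translate of side \<open>j\<close>; gates are
      equivariant, so it also takes one foot to the other and \<open>el_moves_far\<close> gives the
      length 11.\<close>
    let ?y = "P j \<otimes>\<^bsub>F2\<^esub> inv\<^bsub>F2\<^esub> (P (j - 1))"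
    have yel: "?y = el (b j, snd (F ! (j - 1)))"
      using el_mult[OF ac(1,2)[OF j], of "inv\<^bsub>F2\<^esub> (P (j - 1))"] Pstep[OF j] Pc ac(1)[OF j]
      by (simp add: b_def x_def a_def)
    have yc: "?y \<in> carrier F2" using Pc by simp
    have "act ?y ` tr (b j) = tr (b j \<otimes>\<^bsub>F2\<^esub> inv\<^bsub>F2\<^esub> ?y)"
      using act_tr[OF bc[OF j] yc] .
    also have "b j \<otimes>\<^bsub>F2\<^esub> inv\<^bsub>F2\<^esub> ?y = inv\<^bsub>F2\<^esub> (snd (F ! (j - 1))) \<otimes>\<^bsub>F2\<^esub> b j"
    proof -
      have "b j \<otimes>\<^bsub>F2\<^esub> ?y = snd (F ! (j - 1)) \<otimes>\<^bsub>F2\<^esub> b j"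
        using mult_el[OF bc[OF j] ac(2)[OF j]] yel by simp
      then have "inv\<^bsub>F2\<^esub> (snd (F ! (j - 1))) \<otimes>\<^bsub>F2\<^esub> (b j \<otimes>\<^bsub>F2\<^esub> ?y) = b j"
        using C_closed[OF ac(2)[OF j]] bc[OF j] F2_mult_inv_cancel by simp
      then have "inv\<^bsub>F2\<^esub> (snd (F ! (j - 1))) \<otimes>\<^bsub>F2\<^esub> b j \<otimes>\<^bsub>F2\<^esub> ?y = b j"
        using C_closed[OF ac(2)[OF j]] bc[OF j] Pc by (simp add: F2.m_assoc)
      then show ?thesis
        by (rule F2_eq_mult_inv) (use C_closed[OF ac(2)[OF j]] bc[OF j] yc in simp_all)
    qed
    finally have stab: "act ?y ` tr (b j) = tr (b j)" using tr_C[OF bc[OF j] C_inv[OF ac(2)[OF j]]] by simp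
    have "c j = act ?y (c (j - 1))"
      using Pc by (simp add: c_def flip: act_mult) (simp add: F2.m_assoc)
    then have "tree.gate (tr (b j)) (c j) = act ?y ?g"
      using gate_act[OF tr_convex[OF bc[OF j]] cV yc] stab by simp
    then show "11 \<le> vdist ?g (tree.gate (tr (b j)) (c j))"
      using el_moves_far[OF bc[OF j] ac(2,3)[OF j] tree.gate_props(1)[OF tr_convex[OF bc[OF j]] cV]] yel by simp
    fix i assume i: "i \<le> n"
    show "tree.setdist (tr (b j)) (c (j - 1)) \<le> tree.setdist (tr (b j)) (c i)"
      "tree.setdist (tr (b j)) (c j) \<le> tree.setdist (tr (b j)) (c i)"
      using near[OF j i] own[OF j] depth[OF j] by simp_all
  next
    fix j k v w assume j: "j \<in> {1..n}" and k: "k \<in> {1..n}" and ne: "j \<noteq> k" and vw: "v \<in> tr (b k)" "w \<in> tr (b k)"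
    have "b j \<otimes>\<^bsub>F2\<^esub> inv\<^bsub>F2\<^esub> (b k) \<notin> C"
    proof (cases "k < j")
      case True
      then show ?thesis using sep[OF k j] by simp
    next
      case False
      have "inv\<^bsub>F2\<^esub> (b j \<otimes>\<^bsub>F2\<^esub> inv\<^bsub>F2\<^esub> (b k)) = b k \<otimes>\<^bsub>F2\<^esub> inv\<^bsub>F2\<^esub> (b j)"
        using bc[OF j] bc[OF k] by (simp add: F2.inv_mult_group)
      then show ?thesis using sep[OF j k] C_inv False ne by fastforce
    qed
    then show "vdist (tree.gate (tr (b j)) v) (tree.gate (tr (b j)) w) \<le> 1"
      using thin_translates[OF bc[OF j] bc[OF k] _ vw] by simp
  qed
  have "c 0 = c n" using one by (simp add: c_def P_def n_def)
  then show False using not_closed F(2) by (simp add: n_def)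
qed

section \<open>Hurwitz moves and merging\<close>

definition same_coset :: "(letter list \<times> letter list) list \<Rightarrow> letter list \<Rightarrow> bool" where
  "same_coset F a \<longleftrightarrow> a \<in> carrier F2 \<and> (\<forall>p\<in>set F. fst p \<otimes>\<^bsub>F2\<^esub> inv\<^bsub>F2\<^esub> a \<in> C)"

lemma same_coset_prodl:
  assumes "valid F" "same_coset F a"
  shows "a \<otimes>\<^bsub>F2\<^esub> prodl F \<otimes>\<^bsub>F2\<^esub> inv\<^bsub>F2\<^esub> a \<in> C"
  using assms
proof (induction F)
  case Nil
  then show ?case using subgroup.one_closed[OF C_subgroup] by (simp add: same_coset_def)
next
  case (Cons p F)
  obtain b c where p: "p = (b, c)" by force
  have cl: "a \<in> carrier F2" "b \<in> carrier F2" "c \<in> C" "c \<in> carrier F2" "prodl F \<in> carrier F2"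
    using Cons.prems C_closed prodl_closed p by (auto simp: same_coset_def)
  let ?h = "b \<otimes>\<^bsub>F2\<^esub> inv\<^bsub>F2\<^esub> a"
  have h: "?h \<in> C" using Cons.prems p by (simp add: same_coset_def)
  have IH: "a \<otimes>\<^bsub>F2\<^esub> prodl F \<otimes>\<^bsub>F2\<^esub> inv\<^bsub>F2\<^esub> a \<in> C"
    using Cons by (simp add: same_coset_def)
  have "a \<otimes>\<^bsub>F2\<^esub> prodl (p # F) \<otimes>\<^bsub>F2\<^esub> inv\<^bsub>F2\<^esub> a
      = inv\<^bsub>F2\<^esub> ?h \<otimes>\<^bsub>F2\<^esub> c \<otimes>\<^bsub>F2\<^esub> ?h \<otimes>\<^bsub>F2\<^esub> (a \<otimes>\<^bsub>F2\<^esub> prodl F \<otimes>\<^bsub>F2\<^esub> inv\<^bsub>F2\<^esub> a)"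
    using cl p F2_mult_inv_cancel by (simp add: el_eq F2.m_assoc F2.inv_mult_group)
  then show ?case using C_mult C_inv h IH cl(3) by simp
qed

text \<open>The product of the block lies in the conjugate of \<open>C\<close> by \<open>a\<close>,
  so right multiplication by it or its inverse preserves the coset of \<open>a\<close>. This carries
  the conclusion back through a Hurwitz move.\<close>

lemma same_coset_move:
  assumes a: "same_coset B a" "valid B" and b: "b \<in> carrier F2"
  shows "b \<otimes>\<^bsub>F2\<^esub> inv\<^bsub>F2\<^esub> (prodl B) \<otimes>\<^bsub>F2\<^esub> inv\<^bsub>F2\<^esub> a \<in> C \<Longrightarrow> b \<otimes>\<^bsub>F2\<^esub> inv\<^bsub>F2\<^esub> a \<in> C"
    and "b \<otimes>\<^bsub>F2\<^esub> prodl B \<otimes>\<^bsub>F2\<^esub> inv\<^bsub>F2\<^esub> a \<in> C \<Longrightarrow> b \<otimes>\<^bsub>F2\<^esub> inv\<^bsub>F2\<^esub> a \<in> C"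
proof -
  let ?q = "a \<otimes>\<^bsub>F2\<^esub> prodl B \<otimes>\<^bsub>F2\<^esub> inv\<^bsub>F2\<^esub> a"
  have cl: "a \<in> carrier F2" "prodl B \<in> carrier F2" using a prodl_closed by (auto simp: same_coset_def)
  have q: "?q \<in> C" using same_coset_prodl[OF a(2,1)] .
  show "b \<otimes>\<^bsub>F2\<^esub> inv\<^bsub>F2\<^esub> a \<in> C" if h: "b \<otimes>\<^bsub>F2\<^esub> inv\<^bsub>F2\<^esub> (prodl B) \<otimes>\<^bsub>F2\<^esub> inv\<^bsub>F2\<^esub> a \<in> C"
    using C_mult[OF h q] cl b F2_mult_inv_cancel by (simp add: F2.m_assoc)
  show "b \<otimes>\<^bsub>F2\<^esub> inv\<^bsub>F2\<^esub> a \<in> C" if h: "b \<otimes>\<^bsub>F2\<^esub> prodl B \<otimes>\<^bsub>F2\<^esub> inv\<^bsub>F2\<^esub> a \<in> C"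
    using C_mult[OF h C_inv[OF q]] cl b F2_mult_inv_cancel by (simp add: F2.m_assoc F2.inv_mult_group)
qed

text \<open>A Hurwitz move conjugates one factor past a block of others. If no such move lowers the total
  height and no two factors can be made adjacent and merged, the product is a polygon to which
  \<open>prodl_ne_one\<close> applies. A merge of two factors from the normal subsemigroup \<open>S\<close> is never trivial;
  one further factor outside \<open>S\<close> is allowed so that an equation with value in \<open>C\<close> can be treated.\<close>

lemma same_coset_of_prodl_eq_one:
  assumes S: "normal_subsemigroup F2 C S" and S1: "\<one>\<^bsub>F2\<^esub> \<notin> S"
    and "valid F" "prodl F = \<one>\<^bsub>F2\<^esub>" "length (filter (\<lambda>p. snd p \<notin> S) F) \<le> 1"
  shows "(filter (\<lambda>p. snd p \<notin> S) F = [] \<longrightarrow> F = []) \<and> (\<exists>a. same_coset F a)"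
  using assms(3-)
\<comment> \<open>Lexicographic descent: merging shortens the list, a Hurwitz move keeps its length
  and lowers the total height.\<close>
proof (induction F rule: wf_induct_rule[OF wf_measures[of "[length, \<lambda>F. sum_list (map (height \<circ> fst) F)]"]])
  case (1 F)
  note F = 1(2-4)
  let ?bad = "filter (\<lambda>p. snd p \<notin> S)"
  have IH: "(?bad G = [] \<longrightarrow> G = []) \<and> (\<exists>a. same_coset G a)"
    if "length G < length F \<or> length G = length F \<and>
        sum_list (map (height \<circ> fst) G) < sum_list (map (height \<circ> fst) F)"
      "valid G" "prodl G = \<one>\<^bsub>F2\<^esub>" "length (?bad G) \<le> 1" for G
    using 1(1)[of G] that by auto
  consider (empty) "F = []"
    | (left) A B p R where "F = A @ B @ p # R"
        "height (fst p \<otimes>\<^bsub>F2\<^esub> inv\<^bsub>F2\<^esub> (prodl B)) < height (fst p)"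
    | (right) A B p R where "F = A @ p # B @ R" "height (fst p \<otimes>\<^bsub>F2\<^esub> prodl B) < height (fst p)"
    | (merge) A B p q R where "F = A @ p # B @ q # R"
        "fst q \<otimes>\<^bsub>F2\<^esub> inv\<^bsub>F2\<^esub> (prodl B) \<otimes>\<^bsub>F2\<^esub> inv\<^bsub>F2\<^esub> (fst p) \<in> C"
    using prodl_ne_one[OF F(1)] F(2) by (metis not_le)
  then show ?case
  proof cases
    case empty
    then show ?thesis by (auto simp: same_coset_def)
  next
    case (left A B p R)
    obtain a c where p: "p = (a, c)" by force
    let ?b = "prodl B" let ?a = "a \<otimes>\<^bsub>F2\<^esub> inv\<^bsub>F2\<^esub> ?b"
    let ?G = "A @ (?a, c) # B @ R"
    have v: "valid A" "valid B" "valid R" "a \<in> carrier F2" "c \<in> C" "c \<noteq> \<one>\<^bsub>F2\<^esub>"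
      using F(1) left(1) p by auto
    have cl: "?b \<in> carrier F2" "prodl A \<in> carrier F2" "prodl R \<in> carrier F2" "el (a, c) \<in> carrier F2"
      using v prodl_closed el_closed by auto
    have vG: "valid ?G" using v cl by simp
    have "prodl ?G = prodl F"
      using v cl left(1) p F2_mult_inv_cancel el_mult[OF v(4,5), of "inv\<^bsub>F2\<^esub> ?b"]
      by (simp add: prodl_append F2.m_assoc)
    then have G: "(?bad ?G = [] \<longrightarrow> ?G = []) \<and> (\<exists>a. same_coset ?G a)"
      using F left p vG by (intro IH) (auto split: if_splits)
    then obtain d where d: "same_coset ?G d" by blast
    have "a \<otimes>\<^bsub>F2\<^esub> inv\<^bsub>F2\<^esub> d \<in> C"
      using same_coset_move(1)[of B d a] d v by (auto simp: same_coset_def)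
    then have "same_coset F d" using d left(1) p by (auto simp: same_coset_def)
    \<comment> \<open>If all factors of \<open>F\<close> came from \<open>S\<close>, so would those
      of \<open>?G\<close>, and the induction hypothesis would make the nonempty list
      \<open>?G\<close> empty.\<close>
    moreover have "?bad F \<noteq> []" using G left(1) p by (auto split: if_splits)
    ultimately show ?thesis by blast
  next
    case (right A B p R)
    obtain a c where p: "p = (a, c)" by force
    let ?b = "prodl B" let ?a = "a \<otimes>\<^bsub>F2\<^esub> ?b"
    let ?G = "A @ B @ (?a, c) # R"
    have v: "valid A" "valid B" "valid R" "a \<in> carrier F2" "c \<in> C" "c \<noteq> \<one>\<^bsub>F2\<^esub>"
      using F(1) right(1) p by auto
    have cl: "?b \<in> carrier F2" "prodl A \<in> carrier F2" "prodl R \<in> carrier F2" "el (a, c) \<in> carrier F2"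
      using v prodl_closed el_closed by auto
    have vG: "valid ?G" using v cl by simp
    have "prodl ?G = prodl F"
      using v cl right(1) p F2_mult_inv_cancel el_mult[OF v(4,5), of ?b]
      by (simp add: prodl_append F2.m_assoc)
    then have G: "(?bad ?G = [] \<longrightarrow> ?G = []) \<and> (\<exists>a. same_coset ?G a)"
      using F right p vG by (intro IH) (auto split: if_splits)
    then obtain d where d: "same_coset ?G d" by blast
    have "a \<otimes>\<^bsub>F2\<^esub> inv\<^bsub>F2\<^esub> d \<in> C"
      using same_coset_move(2)[of B d a] d v by (auto simp: same_coset_def)
    then have "same_coset F d" using d right(1) p by (auto simp: same_coset_def)
    moreover have "?bad F \<noteq> []" using G right(1) p by (auto split: if_splits)
    ultimately show ?thesis by blast
  next
    case (merge A B p q R)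
    obtain a c where p: "p = (a, c)" by force
    obtain a' c' where q: "q = (a', c')" by force
    \<comment> \<open>Past the block, \<open>q\<close> has the conjugator of \<open>q\<close> times
      the inverse of \<open>?b\<close>, which is \<open>?h\<close> times \<open>a\<close>. As
      \<open>?h\<close> is in \<open>C\<close>, it can be absorbed by conjugating \<open>c'\<close>,
      after which both factors have the conjugator \<open>a\<close>.\<close>
    let ?b = "prodl B" let ?h = "a' \<otimes>\<^bsub>F2\<^esub> inv\<^bsub>F2\<^esub> ?b \<otimes>\<^bsub>F2\<^esub> inv\<^bsub>F2\<^esub> a"
    let ?c = "c \<otimes>\<^bsub>F2\<^esub> conjg F2 c' ?h"
    have h: "?h \<in> C" using merge(2) p q by simp
    have v: "valid A" "valid B" "valid R" "a \<in> carrier F2" "c \<in> C" "c \<noteq> \<one>\<^bsub>F2\<^esub>"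
      "a' \<in> carrier F2" "c' \<in> C" "c' \<noteq> \<one>\<^bsub>F2\<^esub>"
      using F(1) merge(1) p q by auto
    have cl: "?b \<in> carrier F2" "prodl A \<in> carrier F2" "prodl R \<in> carrier F2" "c \<in> carrier F2" "c' \<in> carrier F2"
      using v prodl_closed C_closed by auto
    have cC: "?c \<in> C" using C_mult C_inv h v by (simp add: conjg_def)
    have prodF: "prodl A \<otimes>\<^bsub>F2\<^esub> (el (a, ?c) \<otimes>\<^bsub>F2\<^esub> (prodl B \<otimes>\<^bsub>F2\<^esub> prodl R)) = prodl F"
    proof -
      have "el (a, ?c) \<otimes>\<^bsub>F2\<^esub> ?b = el (a, c) \<otimes>\<^bsub>F2\<^esub> (?b \<otimes>\<^bsub>F2\<^esub> el (a', c'))"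
        using cl v F2_mult_inv_cancel by (simp add: el_eq conjg_def F2.m_assoc F2.inv_mult_group)
      then have "el (a, ?c) \<otimes>\<^bsub>F2\<^esub> (?b \<otimes>\<^bsub>F2\<^esub> prodl R) = el (a, c) \<otimes>\<^bsub>F2\<^esub> (?b \<otimes>\<^bsub>F2\<^esub> (el (a', c') \<otimes>\<^bsub>F2\<^esub> prodl R))"
        using cl v el_closed[OF v(4) cC] el_closed[OF v(4,5)] el_closed[OF v(7,8)] by (simp flip: F2.m_assoc)
      then show ?thesis using v merge(1) p q by (simp add: prodl_append)
    qed
    have cS: "?c \<in> S" if "c \<in> S" "c' \<in> S"
      using S that h unfolding normal_subsemigroup_def by blast
    have coset: "a' \<otimes>\<^bsub>F2\<^esub> inv\<^bsub>F2\<^esub> d \<in> C" if d: "same_coset B d" "a \<otimes>\<^bsub>F2\<^esub> inv\<^bsub>F2\<^esub> d \<in> C" for d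
    proof -
      have dc: "d \<in> carrier F2" using d by (simp add: same_coset_def)
      have "?h \<otimes>\<^bsub>F2\<^esub> (a \<otimes>\<^bsub>F2\<^esub> inv\<^bsub>F2\<^esub> d) = a' \<otimes>\<^bsub>F2\<^esub> inv\<^bsub>F2\<^esub> ?b \<otimes>\<^bsub>F2\<^esub> inv\<^bsub>F2\<^esub> d"
        using cl v dc F2_mult_inv_cancel by (simp add: F2.m_assoc)
      then show ?thesis using same_coset_move(1)[OF d(1) v(2,7)] C_mult[OF h d(2)] by simp
    qed
    show ?thesis
    proof (cases "?c = \<one>\<^bsub>F2\<^esub>")
      case True
      let ?G = "A @ B @ R"
      \<comment> \<open>A trivial merge must involve the one factor outside \<open>S\<close>. The
        remaining list has none left, so it is empty by induction and \<open>F\<close> consists of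
        \<open>p\<close> and \<open>q\<close> only.\<close>
      have "c \<notin> S \<or> c' \<notin> S" using cS S1 True by auto
      then have bad: "?bad F \<noteq> []" "?bad ?G = []"
        using F(3) merge(1) p q by (auto split: if_splits)
      have "el (a, ?c) = \<one>\<^bsub>F2\<^esub>" using True v by (simp add: el_eq)
      then have "prodl ?G = \<one>\<^bsub>F2\<^esub>" using prodF F(2) v cl by (simp add: prodl_append)
      then have "?G = []" using IH[of ?G] merge(1) v bad(2) by auto
      moreover have "same_coset [] a" using v by (simp add: same_coset_def)
      moreover have "a \<otimes>\<^bsub>F2\<^esub> inv\<^bsub>F2\<^esub> a \<in> C" using v subgroup.one_closed[OF C_subgroup] by simp
      ultimately have "same_coset F a" using coset[of a] merge(1) p q by (auto simp: same_coset_def)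
      then show ?thesis using bad(1) by blast
    next
      case False
      let ?G = "A @ (a, ?c) # B @ R"
      have "length (?bad ?G) \<le> length (?bad F)" using merge(1) p q cS by auto
      moreover have vG: "valid ?G" using v cC False by simp
      moreover have "prodl ?G = \<one>\<^bsub>F2\<^esub>" using prodF F(2) v cC False by (simp add: prodl_append)
      ultimately have G: "(?bad ?G = [] \<longrightarrow> ?G = []) \<and> (\<exists>a. same_coset ?G a)"
        using F(3) merge(1) by (intro IH) auto
      then obtain d where d: "same_coset ?G d" by blast
      have "a' \<otimes>\<^bsub>F2\<^esub> inv\<^bsub>F2\<^esub> d \<in> C" using coset[of d] d by (auto simp: same_coset_def)
      then have "same_coset F d" using d merge(1) p q by (auto simp: same_coset_def)
      moreover have "?bad F \<noteq> []" using G merge(1) p q cS by (auto split: if_splits)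
      ultimately show ?thesis by blast
    qed
  qed
qed

theorem C_multi_malnormal: "multi_malnormal F2 C"
  unfolding multi_malnormal_def
proof (intro conjI allI impI)
  show "subgroup C F2" by (rule C_subgroup)
  fix S cs as
  assume S: "normal_subsemigroup F2 C S \<and> \<one>\<^bsub>F2\<^esub> \<notin> S"
    and l: "length cs = length as \<and> cs \<noteq> [] \<and> set cs \<subseteq> S \<and> set as \<subseteq> carrier F2 - C"
  let ?F = "zip as cs"
  let ?x = "listprod F2 (map2 (conjg F2) cs as)"
  have SC: "S \<subseteq> C" using S by (simp add: normal_subsemigroup_def)
  have "map2 (conjg F2) cs as = map el ?F"
    using l by (intro nth_equalityI) (auto simp: el_def)
  then have x: "?x = prodl ?F" by (simp add: prodl_def)
  have mem: "fst p \<in> carrier F2 - C" "snd p \<in> S" if "p \<in> set ?F" for p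
  proof -
    have "fst p \<in> set as" "snd p \<in> set cs"
      using that set_zip_leftD[of "fst p" "snd p" as cs] set_zip_rightD[of "fst p" "snd p" as cs] by simp_all
    then show "fst p \<in> carrier F2 - C" "snd p \<in> S" using l by blast+
  qed
  have vF: "valid ?F"
    unfolding valid_def
  proof
    fix p assume "p \<in> set ?F"
    from mem[OF this] show "fst p \<in> carrier F2 \<and> snd p \<in> C \<and> snd p \<noteq> \<one>\<^bsub>F2\<^esub>"
      using SC S by (metis DiffD1 subsetD)
  qed
  have bF: "filter (\<lambda>p. snd p \<notin> S) ?F = []" using mem by (simp add: filter_empty_conv)
  have ne: "?F \<noteq> []" using l by auto
  have "?x \<notin> C"
  proof
    assume xC: "?x \<in> C"
    show False
    proof (cases "?x = \<one>\<^bsub>F2\<^esub>")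
      case True
      then show False using same_coset_of_prodl_eq_one[of S ?F] S vF x bF ne by auto
    next
      case False
      let ?y = "inv\<^bsub>F2\<^esub> ?x"
      \<comment> \<open>The inverse of the value is the one factor allowed outside \<open>S\<close>.
        Its conjugator is trivial, so the common coset is \<open>C\<close> itself, and every given
        conjugator would lie in \<open>C\<close>.\<close>
      let ?G = "?F @ [(\<one>\<^bsub>F2\<^esub>, ?y)]"
      have y: "?y \<in> C" "?y \<noteq> \<one>\<^bsub>F2\<^esub>" using C_inv[OF xC] False C_closed[OF xC] by auto
      have vG: "valid ?G" using vF y by simp
      have "prodl ?G = \<one>\<^bsub>F2\<^esub>"
        using vF y C_closed[OF xC] x by (simp add: prodl_append el_eq)
      moreover have bG: "length (filter (\<lambda>p. snd p \<notin> S) ?G) \<le> 1"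
        unfolding filter_append bF by simp
      ultimately obtain d where d: "same_coset ?G d"
        using same_coset_of_prodl_eq_one[of S ?G] S vG bG by blast
      obtain p F' where F': "?F = p # F'" using ne by (cases ?F) auto
      have dc: "d \<in> carrier F2" using d by (simp add: same_coset_def)
      have "fst p \<otimes>\<^bsub>F2\<^esub> inv\<^bsub>F2\<^esub> d \<in> C" "inv\<^bsub>F2\<^esub> d \<in> C"
        using d F' dc by (auto simp: same_coset_def)
      then have "fst p \<otimes>\<^bsub>F2\<^esub> inv\<^bsub>F2\<^esub> d \<otimes>\<^bsub>F2\<^esub> inv\<^bsub>F2\<^esub> (inv\<^bsub>F2\<^esub> d) \<in> C"
        using C_mult C_inv by blast
      moreover have "fst p \<in> carrier F2 - C" using mem(1)[of p] F' by simp
      ultimately show False using dc by (simp add: F2.m_assoc)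
    qed
  qed
  then show "?x \<in> carrier F2 - C" using x prodl_closed[OF vF] by simp
qed

end

section \<open>The graph of the subgroup\<close>

locale petals =
  fixes m s :: nat and kk :: "bool \<Rightarrow> nat \<Rightarrow> nat \<Rightarrow> int"
  assumes m: "m \<ge> 1" and s: "s \<ge> 10"
    and nz: "\<lbrakk>i \<in> {1..m}; j \<in> {1..s}\<rbrakk> \<Longrightarrow> kk t i j \<noteq> 0"
    and inj: "inj_on (case_sum (\<lambda>(i, j). \<bar>kk t i j\<bar>)
        (\<lambda>(i, i'). \<bar>kk t i (if t then s else 1) - kk t i' (if t then s else 1)\<bar>))
      (Inl ` ({1..m} \<times> {1..s}) \<union> Inr ` {(i, i'). 1 \<le> i \<and> i < i' \<and> i' \<le> m})"
begin

text \<open>The state \<open>(i, r)\<close> is the edge reached after the first \<open>r\<close> of the \<open>2 s\<close> syllables of the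
  \<open>i\<close>-th generator; the base edge, where \<open>r\<close> is \<open>0\<close> or \<open>2 s\<close>, is represented by \<open>(0, 0)\<close> only.\<close>

definition E :: "(nat \<times> nat) set" where "E = insert (0, 0) ({1..m} \<times> {1..2 * s - 1})"

text \<open>Along a petal, edges \<open>2 q\<close> and \<open>2 q + 1\<close> meet at an end of
  type a (\<open>t\<close> false), edges \<open>2 q - 1\<close> and \<open>2 q\<close> at an end of
  type b. The value \<open>(0, 0)\<close> names the two ends of the base edge, one for each
  \<open>t\<close>, where all petals meet.\<close>

definition node :: "bool \<Rightarrow> nat \<times> nat \<Rightarrow> nat \<times> nat" where
  "node t e = (let (i, r) = e in
     if t then if r = 0 \<or> r = 2 * s - 1 then (0, 0) else (i, (r + 1) div 2)
     else if r div 2 = 0 then (0, 0) else (i, r div 2))"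

text \<open>Only differences at a common node matter. Along a petal they are the exponents; at the
  base ends the offsets of \<open>(i, 1)\<close> and \<open>(i, 2 * s - 1)\<close> are the first
  exponent of a and minus the last exponent of b, so that passing between petals reads the
  differences in (A).\<close>

definition off :: "bool \<Rightarrow> nat \<times> nat \<Rightarrow> int" where
  "off t e = (let (i, r) = e in
     if t then if r = 0 then 0 else if r = 2 * s - 1 then - kk True i s
       else if even r then kk True i (r div 2) else 0
     else if odd r then kk False i (r div 2 + 1) else 0)"

fun syll :: "nat \<Rightarrow> nat \<Rightarrow> letter list" where
  "syll i 0 = \<one>\<^bsub>F2\<^esub>"
| "syll i (Suc r) = syll i r \<otimes>\<^bsub>F2\<^esub> pw (odd r) (kk (odd r) i (r div 2 + 1))"

definition u :: "nat \<times> nat \<Rightarrow> letter list" where "u e = syll (fst e) (snd e)"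

definition gens :: "letter list set" where "gens = (\<lambda>i. syll i (2 * s)) ` {1..m}"

definition C :: "letter list set" where "C = generate F2 gens"

lemma syll_closed [simp]: "syll i r \<in> carrier F2"
  by (induction r) auto

lemma last_odd: "2 * q \<noteq> 2 * s - 1"
proof -
  obtain s' where "s = Suc s'" using s by (cases s) auto
  then show ?thesis by simp presburger
qed

lemma C_subgroup: "subgroup C F2"
  unfolding C_def by (rule F2.generate_is_subgroup) (auto simp: gens_def)

lemma gens_C: "i \<in> {1..m} \<Longrightarrow> syll i (2 * s) \<in> C"
  unfolding C_def gens_def by (intro generate.incl) auto

lemma same_node_cases:
  assumes "(i, r) \<in> E" "(i', r') \<in> E" "node t (i, r) = node t (i', r')" "(i, r) \<noteq> (i', r')"
  shows "if t then (r = 0 \<or> r = 2 * s - 1) \<and> (r' = 0 \<or> r' = 2 * s - 1)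
      \<or> i = i' \<and> (odd r \<and> r' = r + 1 \<or> odd r' \<and> r = r' + 1)
    else (r = 0 \<or> r = 1) \<and> (r' = 0 \<or> r' = 1)
      \<or> i = i' \<and> (even r \<and> r' = r + 1 \<or> even r' \<and> r = r' + 1)"
proof (cases t)
  case True
  have "(r = 0 \<or> r = 2 * s - 1) \<and> (r' = 0 \<or> r' = 2 * s - 1) \<or>
      i = i' \<and> (r + 1) div 2 = (r' + 1) div 2 \<and> r \<noteq> r'"
    using assms True by (auto simp: node_def E_def split: if_splits)
  moreover have "odd r \<and> r' = r + 1 \<or> odd r' \<and> r = r' + 1" if "(r + 1) div 2 = (r' + 1) div 2" "r \<noteq> r'"
    using that by presburger
  ultimately show ?thesis using True by metis
next
  case False
  have "r div 2 = 0 \<and> r' div 2 = 0 \<or> i = i' \<and> r div 2 = r' div 2 \<and> r \<noteq> r'"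
    using assms False by (auto simp: node_def E_def split: if_splits)
  moreover have "even r \<and> r' = r + 1 \<or> even r' \<and> r = r' + 1" if "r div 2 = r' div 2" "r \<noteq> r'"
    using that by presburger
  moreover have "q = 0 \<or> q = 1" if "q div 2 = 0" for q :: nat using that by presburger
  ultimately show ?thesis using False by metis
qed

section \<open>Turns of the graph and condition (A)\<close>

definition turns :: "(nat \<times> nat + nat \<times> nat) set" where
  "turns = Inl ` ({1..m} \<times> {1..s}) \<union> Inr ` {(i, i'). 1 \<le> i \<and> i < i' \<and> i' \<le> m}"

definition size_of :: "bool \<Rightarrow> nat \<times> nat + nat \<times> nat \<Rightarrow> int" where
  "size_of t = case_sum (\<lambda>(i, j). \<bar>kk t i j\<bar>)
     (\<lambda>(i, i'). \<bar>kk t i (if t then s else 1) - kk t i' (if t then s else 1)\<bar>)"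

text \<open>Each turn is given one of its two orientations. Reversing it only changes the sign of
  the power read, whereas (A) speaks of absolute values.\<close>

definition src :: "bool \<Rightarrow> nat \<times> nat + nat \<times> nat \<Rightarrow> nat \<times> nat" where
  "src t = case_sum (\<lambda>(i, j). if t then (i, 2 * j - 1) else if j = 1 then (0, 0) else (i, 2 * j - 2))
     (\<lambda>(i, i'). if t then (i, 2 * s - 1) else (i, 1))"

definition tgt :: "bool \<Rightarrow> nat \<times> nat + nat \<times> nat \<Rightarrow> nat \<times> nat" where
  "tgt t = case_sum (\<lambda>(i, j). if t then if j = s then (0, 0) else (i, 2 * j) else (i, 2 * j - 1))
     (\<lambda>(i, i'). if t then (i', 2 * s - 1) else (i', 1))"

lemma size_inj: "\<lbrakk>x \<in> turns; y \<in> turns; size_of t x = size_of t y\<rbrakk> \<Longrightarrow> x = y"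
  using inj[of t] unfolding turns_def size_of_def inj_on_def by blast

text \<open>A vanishing difference would mean two equal exponents on different petals, which (A)
  excludes.\<close>

lemma size_nz:
  assumes "x \<in> turns"
  shows "size_of t x \<noteq> 0"
proof (cases x)
  case (Inl p)
  then show ?thesis using assms nz by (auto simp: turns_def size_of_def)
next
  case (Inr p)
  then obtain i i' where p: "x = Inr (i, i')" "1 \<le> i" "i < i'" "i' \<le> m"
    using assms by (auto simp: turns_def)
  show ?thesis
  proof
    let ?j = "if t then s else 1"
    assume "size_of t x = 0"
    then have "size_of t (Inl (i, ?j)) = size_of t (Inl (i', ?j))" using p by (simp add: size_of_def)
    moreover have "Inl (i, ?j) \<in> turns" "Inl (i', ?j) \<in> turns" using p s by (auto simp: turns_def)
    ultimately show False using size_inj p by blast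
  qed
qed

lemma abs_off_turn:
  assumes "x \<in> turns"
  shows "\<bar>off t (tgt t x) - off t (src t x)\<bar> = size_of t x"
proof (cases x)
  case (Inl p)
  then obtain i j where p: "x = Inl (i, j)" "1 \<le> i" "i \<le> m" "1 \<le> j" "j \<le> s"
    using assms by (auto simp: turns_def)
  obtain q where q: "j = Suc q" using p(4) by (cases j) auto
  have "odd (2 * j - 1)" "even (2 * j - 2)" "(2 * j - 1) div 2 + 1 = j" by (simp_all add: q)
  moreover have "2 * j - 1 \<noteq> 0" "2 * j \<noteq> 0" using p(4) by simp_all
  moreover have "2 * j \<noteq> 2 * s - 1" by (rule last_odd)
  moreover have "2 * j - 1 = 2 * s - 1 \<longleftrightarrow> j = s" using p(4) s by arith
  ultimately have o: "off True (i, 2 * j) = kk True i j" "off False (i, 2 * j - 1) = kk False i j"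
    "off False (i, 2 * j - 2) = 0" "off True (i, 2 * j - 1) = (if j = s then - kk True i s else 0)"
    "off t (0, 0) = 0" for t
    by (simp_all add: off_def)
  show ?thesis
  proof (cases t)
    case True
    then have "src t x = (i, 2 * j - 1)" "tgt t x = (if j = s then (0, 0) else (i, 2 * j))"
      by (simp_all add: p(1) src_def tgt_def)
    moreover have "size_of t x = \<bar>kk True i j\<bar>" using True by (simp add: p(1) size_of_def)
    ultimately show ?thesis using True o(1,4,5) by (cases "j = s") simp_all
  next
    case False
    then have "src t x = (if j = 1 then (0, 0) else (i, 2 * j - 2))" "tgt t x = (i, 2 * j - 1)"
      by (simp_all add: p(1) src_def tgt_def)
    moreover have "size_of t x = \<bar>kk False i j\<bar>" using False by (simp add: p(1) size_of_def)
    ultimately show ?thesis using False o(2,3,5) by (cases "j = 1") simp_all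
  qed
next
  case (Inr p)
  then obtain i i' where p: "x = Inr (i, i')" by force
  have o: "off True (k, 2 * s - 1) = - kk True k s" "off False (k, 1) = kk False k 1" for k
    using s by (simp_all add: off_def)
  show ?thesis
  proof (cases t)
    case True
    then have "src t x = (i, 2 * s - 1)" "tgt t x = (i', 2 * s - 1)" "size_of t x = \<bar>kk True i s - kk True i' s\<bar>"
      by (simp_all add: p src_def tgt_def size_of_def)
    then show ?thesis using True o(1) by simp
  next
    case False
    then have "src t x = (i, 1)" "tgt t x = (i', 1)" "size_of t x = \<bar>kk False i 1 - kk False i' 1\<bar>"
      by (simp_all add: p src_def tgt_def size_of_def)
    then show ?thesis using False o(2) by (simp add: abs_minus_commute)
  qed
qed

lemma turn_of_edges:
  assumes "e \<in> E" "f \<in> E" "node t e = node t f" "e \<noteq> f"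
  shows "\<exists>x\<in>turns. e = src t x \<and> f = tgt t x \<or> f = src t x \<and> e = tgt t x"
proof -
  have *: "\<exists>x\<in>turns. (i, r) = src t x \<and> (i', r') = tgt t x \<or> (i', r') = src t x \<and> (i, r) = tgt t x"
    if a: "(i, r) \<in> E" "(i', r') \<in> E" "node t (i, r) = node t (i', r')" "(i, r) \<noteq> (i', r')" "r \<le> r'"
    for i r i' r'
  proof -
    have c: "if t then (r = 0 \<or> r = 2 * s - 1) \<and> (r' = 0 \<or> r' = 2 * s - 1) \<or> i = i' \<and> odd r \<and> r' = r + 1
      else (r = 0 \<or> r = 1) \<and> (r' = 0 \<or> r' = 1) \<or> i = i' \<and> even r \<and> r' = r + 1"
      using same_node_cases[OF a(1-4)] a(5) by (cases t) auto
    have i': "i' \<in> {1..m}" "r' \<in> {1..2 * s - 1}" using a by (auto simp: E_def)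
    consider (base) "(i, r) = (0, 0)" "if t then r' = 2 * s - 1 else r' = 1"
      | (petal) "i = i'" "r' = r + 1" "if t then odd r else even r" "r \<noteq> 0"
      | (special) "i \<noteq> i'" "i \<in> {1..m}" "r = r'" "if t then r = 2 * s - 1 else r = 1"
      using c a by (cases t) (auto simp: E_def)
    then show ?thesis
    proof cases
      case base
      then have "Inl (i', if t then s else 1) \<in> turns" using i' s by (auto simp: turns_def)
      then show ?thesis
        using base s by (intro bexI[of _ "Inl (i', if t then s else 1)"]) (auto simp: src_def tgt_def)
    next
      case petal
      let ?j = "if t then (r + 1) div 2 else r div 2 + 1"
      have "?j \<in> {1..s}" using petal i' s by (auto split: if_splits)
      then have "Inl (i, ?j) \<in> turns" using petal i' by (auto simp: turns_def)
      moreover have "(i, r) = src t (Inl (i, ?j))" "(i', r') = tgt t (Inl (i, ?j))"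
      proof -
        have "(i, r) = src t (Inl (i, ?j)) \<and> (i', r') = tgt t (Inl (i, ?j))"
        proof (cases t)
          case True
          then obtain q where "r = 2 * q + 1" using petal(3) by (auto elim: oddE)
          then show ?thesis using True petal i' by (auto simp: src_def tgt_def)
        next
          case False
          then obtain q where "r = 2 * q" "q \<noteq> 0" using petal(3,4) by (auto elim: evenE)
          then show ?thesis using False petal by (auto simp: src_def tgt_def)
        qed
        then show "(i, r) = src t (Inl (i, ?j))" "(i', r') = tgt t (Inl (i, ?j))" by blast+
      qed
      ultimately show ?thesis by blast
    next
      case special
      have "Inr (min i i', max i i') \<in> turns" using special i' by (auto simp: turns_def min_def max_def)
      then show ?thesis
        using special by (intro bexI[of _ "Inr (min i i', max i i')"]) (auto simp: src_def tgt_def min_def max_def split: if_splits)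
    qed
  qed
  obtain i r i' r' where e: "e = (i, r)" "f = (i', r')" by force
  show ?thesis
  proof (cases "r \<le> r'")
    case True
    then show ?thesis using *[of i r i' r'] assms e by blast
  next
    case False
    then show ?thesis using *[of i' r' i r] assms e by (metis nat_le_linear)
  qed
qed

section \<open>Labels of the states modulo the subgroup\<close>

lemma C_mult: "\<lbrakk>x \<in> C; y \<in> C\<rbrakk> \<Longrightarrow> x \<otimes>\<^bsub>F2\<^esub> y \<in> C"
  using subgroup.m_closed[OF C_subgroup] .

lemma C_inv: "x \<in> C \<Longrightarrow> inv\<^bsub>F2\<^esub> x \<in> C"
  using subgroup.m_inv_closed[OF C_subgroup] .

text \<open>A label for a node, from which an edge there is reached by the power given by
  \<open>off\<close>. For the base end of type b the truncated \<open>2 * 0 - 1\<close> is 0, so the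
  label is trivial, as it should be.\<close>

definition at_node :: "bool \<Rightarrow> nat \<times> nat \<Rightarrow> letter list" where
  "at_node t v = (if t then syll (fst v) (2 * snd v - 1) else syll (fst v) (2 * snd v))"

lemma u_at_node:
  assumes "e \<in> E"
  shows "\<exists>c\<in>C. u e = c \<otimes>\<^bsub>F2\<^esub> at_node t (node t e) \<otimes>\<^bsub>F2\<^esub> pw t (off t e)"
proof -
  obtain i r where e: "e = (i, r)" by force
  have oneC: "\<one>\<^bsub>F2\<^esub> \<in> C" using subgroup.one_closed[OF C_subgroup] .
  show ?thesis
  proof (cases t)
    case True
    consider "r = 0" "i = 0" | "r = 2 * s - 1" "i \<in> {1..m}" | q where "r = 2 * q" "q \<noteq> 0" | q where "r = 2 * q + 1" "r \<noteq> 2 * s - 1"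
    proof -
      assume a: "r = 0 \<Longrightarrow> i = 0 \<Longrightarrow> thesis" "r = 2 * s - 1 \<Longrightarrow> i \<in> {1..m} \<Longrightarrow> thesis"
        "\<And>q. r = 2 * q \<Longrightarrow> q \<noteq> 0 \<Longrightarrow> thesis" "\<And>q. r = 2 * q + 1 \<Longrightarrow> r \<noteq> 2 * s - 1 \<Longrightarrow> thesis"
      have "(r = 0 \<and> i = 0) \<or> (i \<in> {1..m} \<and> r \<noteq> 0)" using assms e by (auto simp: E_def)
      moreover have "(\<exists>q. r = 2 * q) \<or> (\<exists>q. r = 2 * q + 1)" by presburger
      ultimately show thesis using a by (metis mult_0_right)
    qed
    then show ?thesis
    proof cases
      case 1
      then show ?thesis using True e oneC by (intro bexI[of _ "\<one>\<^bsub>F2\<^esub>"]) (auto simp: u_def node_def off_def at_node_def)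
    next
      case 2
      \<comment> \<open>The last edge of a petal reaches the base end only after a full turn around
        the petal: this is where the generator enters as the coefficient from
        \<open>C\<close>.\<close>
      let ?p = "pw True (kk True i s)"
      have r: "2 * s = Suc r" "odd r" "r div 2 + 1 = s" using 2(1) s by presburger+
      have "syll i (2 * s) = syll i r \<otimes>\<^bsub>F2\<^esub> ?p" using r by simp
      then have "syll i r = syll i (2 * s) \<otimes>\<^bsub>F2\<^esub> inv\<^bsub>F2\<^esub> ?p" by (simp add: F2.m_assoc)
      moreover have "off t e = - kk True i s" "node t e = (0, 0)"
        using True e 2 s by (auto simp: off_def node_def)
      ultimately show ?thesis
        using gens_C[OF 2(2)] True e by (intro bexI[of _ "syll i (2 * s)"]) (auto simp: u_def at_node_def pw_minus)
    next
      case (3 q)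
      then have r: "(r + 1) div 2 = q" "r \<noteq> 2 * s - 1" "r = Suc (2 * q - 1)" "odd (2 * q - 1)" "(2 * q - 1) div 2 + 1 = q"
        using s by presburger+
      have "syll i r = syll i (2 * q - 1) \<otimes>\<^bsub>F2\<^esub> pw True (kk True i q)"
        using r(3-5) syll.simps(2)[of i "2 * q - 1"] by simp
      then show ?thesis
        using True e oneC 3 r(1,2) by (intro bexI[of _ "\<one>\<^bsub>F2\<^esub>"]) (auto simp: u_def node_def off_def at_node_def)
    next
      case (4 q)
      then have r: "(r + 1) div 2 = q + 1" by presburger
      then show ?thesis
        using True e oneC 4 by (intro bexI[of _ "\<one>\<^bsub>F2\<^esub>"]) (auto simp: u_def node_def off_def at_node_def)
    qed
  next
    case False
    consider "r = 0" "i = 0" | q where "r = 2 * q" "q \<noteq> 0" | q where "r = 2 * q + 1"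
    proof -
      assume a: "r = 0 \<Longrightarrow> i = 0 \<Longrightarrow> thesis"
        "\<And>q. r = 2 * q \<Longrightarrow> q \<noteq> 0 \<Longrightarrow> thesis" "\<And>q. r = 2 * q + 1 \<Longrightarrow> thesis"
      have "(r = 0 \<and> i = 0) \<or> r \<noteq> 0" using assms e by (auto simp: E_def)
      moreover have "(\<exists>q. r = 2 * q) \<or> (\<exists>q. r = 2 * q + 1)" by presburger
      ultimately show thesis using a by (metis mult_0_right)
    qed
    then show ?thesis
    proof cases
      case 1
      then show ?thesis using False e oneC by (intro bexI[of _ "\<one>\<^bsub>F2\<^esub>"]) (auto simp: u_def node_def off_def at_node_def)
    next
      case (2 q)
      then show ?thesis using False e oneC by (intro bexI[of _ "\<one>\<^bsub>F2\<^esub>"]) (auto simp: u_def node_def off_def at_node_def)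
    next
      case (3 q)
      then show ?thesis using False e oneC by (intro bexI[of _ "\<one>\<^bsub>F2\<^esub>"]) (auto simp: u_def node_def off_def at_node_def)
    qed
  qed
qed

lemma u_turn:
  assumes "e \<in> E" "f \<in> E" "node t e = node t f"
  shows "u e \<otimes>\<^bsub>F2\<^esub> pw t (off t f - off t e) \<otimes>\<^bsub>F2\<^esub> inv\<^bsub>F2\<^esub> (u f) \<in> C"
proof -
  let ?x = "at_node t (node t f)"
  obtain c where c: "c \<in> C" "u e = c \<otimes>\<^bsub>F2\<^esub> ?x \<otimes>\<^bsub>F2\<^esub> pw t (off t e)"
    using u_at_node[OF assms(1), of t] assms(3) by auto
  obtain c' where c': "c' \<in> C" "u f = c' \<otimes>\<^bsub>F2\<^esub> ?x \<otimes>\<^bsub>F2\<^esub> pw t (off t f)"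
    using u_at_node[OF assms(2), of t] by auto
  have cl: "c \<in> carrier F2" "c' \<in> carrier F2" "?x \<in> carrier F2"
    using c c' subgroup.mem_carrier[OF C_subgroup] by (auto simp: at_node_def)
  have p: "pw t (off t f) = pw t (off t e) \<otimes>\<^bsub>F2\<^esub> pw t (off t f - off t e)"
    by (simp flip: pw_add)
  have "u e \<otimes>\<^bsub>F2\<^esub> pw t (off t f - off t e) = c \<otimes>\<^bsub>F2\<^esub> ?x \<otimes>\<^bsub>F2\<^esub> pw t (off t f)"
    unfolding p c(2) using cl by (simp add: F2.m_assoc)
  then have "u e \<otimes>\<^bsub>F2\<^esub> pw t (off t f - off t e) \<otimes>\<^bsub>F2\<^esub> inv\<^bsub>F2\<^esub> (u f) = c \<otimes>\<^bsub>F2\<^esub> inv\<^bsub>F2\<^esub> c'"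
    unfolding c'(2) using cl F2_mult_inv_cancel by (simp add: F2.m_assoc F2.inv_mult_group)
  then show ?thesis using C_mult[OF c(1) C_inv[OF c'(1)]] by simp
qed

lemma off_diff_nz:
  assumes "e \<in> E" "f \<in> E" "node t e = node t f" "e \<noteq> f"
  shows "off t f - off t e \<noteq> 0"
proof -
  obtain x where x: "x \<in> turns" "e = src t x \<and> f = tgt t x \<or> f = src t x \<and> e = tgt t x"
    using turn_of_edges[OF assms] by blast
  then have "\<bar>off t f - off t e\<bar> = size_of t x"
    using abs_off_turn[OF x(1), of t] by (auto simp: abs_minus_commute)
  then show ?thesis using size_nz[OF x(1), of t] by auto
qed

sublocale automaton E node off "(0, 0)" u C
proof (rule automaton.intro)
  fix e f t assume ef: "e \<in> E" "f \<in> E" "node t e = node t f" "off t e = off t f"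
  then show "e = f" using off_diff_nz[OF ef(1-3)] by auto
next
  fix e f e' f' t
  assume E: "e \<in> E" "f \<in> E" "e' \<in> E" "f' \<in> E" and n: "node t e = node t f" "node t e' = node t f'"
    and eq: "off t f - off t e = off t f' - off t e'" and ne: "e \<noteq> f"
  have nz: "off t f - off t e \<noteq> 0" using off_diff_nz[OF E(1,2) n(1) ne] .
  then have ne': "e' \<noteq> f'" using eq by auto
  obtain x where x: "x \<in> turns" "e = src t x \<and> f = tgt t x \<or> f = src t x \<and> e = tgt t x"
    using turn_of_edges[OF E(1,2) n(1) ne] by blast
  obtain y where y: "y \<in> turns" "e' = src t y \<and> f' = tgt t y \<or> f' = src t y \<and> e' = tgt t y"
    using turn_of_edges[OF E(3,4) n(2) ne'] by blast
  have "size_of t x = size_of t y"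
    using x y abs_off_turn[OF x(1), of t] abs_off_turn[OF y(1), of t] eq by (auto simp: abs_minus_commute)
  then have "x = y" using size_inj x(1) y(1) by blast
  \<comment> \<open>Both pairs are the same unoriented turn, and the common nonzero value with its
    sign rules out opposite orientations.\<close>
  then show "e = e'" using x(2) y(2) eq nz by auto
next
  fix e assume e: "e \<in> E"
  then obtain i r where ir: "e = (i, r)" by force
  consider "e = (0, 0)" | "r = 2 * s - 1" | "i \<in> {1..m}" "even r" "2 \<le> r" "r \<le> 2 * s - 1"
    | "i \<in> {1..m}" "odd r" "r + 1 \<le> 2 * s - 1"
  proof -
    have "e = (0, 0) \<or> i \<in> {1..m} \<and> 1 \<le> r \<and> r \<le> 2 * s - 1" using e ir by (auto simp: E_def)
    moreover have "2 \<le> r" if "even r" "1 \<le> r" using that by presburger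
    moreover have "r = 2 * s - 1 \<or> r + 1 \<le> 2 * s - 1" if "r \<le> 2 * s - 1" using that by linarith
    ultimately show thesis using that by blast
  qed
  then have "\<exists>f\<in>E. f \<noteq> e \<and> node True f = node True e"
  proof cases
    case 1
    then show ?thesis using m s by (intro bexI[of _ "(1, 2 * s - 1)"]) (auto simp: E_def node_def)
  next
    case 2
    then show ?thesis using ir s by (intro bexI[of _ "(0, 0)"]) (auto simp: E_def node_def)
  next
    case 3
    then obtain q where "r = 2 * q" by blast
    then show ?thesis using ir s 3 last_odd[of q]
      by (intro bexI[of _ "(i, r - 1)"]) (auto simp: E_def node_def)
  next
    case 4
    then obtain q where "r = 2 * q + 1" by (auto elim: oddE)
    then show ?thesis using ir s 4 last_odd[of "Suc q"]
      by (intro bexI[of _ "(i, r + 1)"]) (auto simp: E_def node_def)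
  qed
  then show "\<exists>t. \<exists>f\<in>E. f \<noteq> e \<and> node t f = node t e" by blast
next
  show "(0, 0) \<in> E" by (simp add: E_def)
  show "subgroup C F2" by (rule C_subgroup)
  show "u (0, 0) = \<one>\<^bsub>F2\<^esub>" by (simp add: u_def)
qed (simp_all add: u_def u_turn[unfolded u_def])

section \<open>Closed runs in the graph\<close>

lemma run_append: "run e t (v @ w) f \<longleftrightarrow> (\<exists>g. run e t v g \<and> run g (if even (length v) then t else \<not> t) w f)"
proof (induction v arbitrary: e t)
  case (Cons k v)
  then show ?case by (auto; metis)
qed simp

definition adj :: "bool \<Rightarrow> nat \<times> nat \<Rightarrow> nat \<times> nat \<Rightarrow> bool" where
  "adj t e f \<longleftrightarrow> f \<in> E \<and> node t e = node t f \<and> e \<noteq> f"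

lemma run_Cons_adj: "\<lbrakk>run e t (k # w) f; k \<noteq> 0\<rbrakk> \<Longrightarrow> \<exists>e'. adj t e e' \<and> run e' (\<not> t) w f"
proof -
  assume "run e t (k # w) f" "k \<noteq> 0"
  then obtain e' where e': "e' \<in> E" "node t e' = node t e" "off t e' = off t e + k" "run e' (\<not> t) w f"
    by auto
  then have "e \<noteq> e'" using \<open>k \<noteq> 0\<close> by auto
  then show ?thesis using e' by (metis adj_def)
qed

lemma adj_cases:
  assumes "(i, r) \<in> E" "adj t (i, r) e"
  shows "\<lbrakk>t = odd r; 1 \<le> r; r < 2 * s - 1\<rbrakk> \<Longrightarrow> e = (i, r + 1)"
    and "\<lbrakk>t; r = 2 * s - 1\<rbrakk> \<Longrightarrow> e = (0, 0) \<or> (\<exists>i'. i' \<noteq> i \<and> i' \<noteq> 0 \<and> e = (i', 2 * s - 1))"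
    and "\<lbrakk>t \<noteq> odd r; 2 \<le> r\<rbrakk> \<Longrightarrow> e = (i, r - 1)"
    and "\<lbrakk>\<not> t; r = 1\<rbrakk> \<Longrightarrow> e = (0, 0) \<or> (\<exists>i'. i' \<noteq> i \<and> i' \<noteq> 0 \<and> e = (i', 1))"
    and "\<lbrakk>\<not> t; r = 0\<rbrakk> \<Longrightarrow> \<exists>i'. i' \<noteq> 0 \<and> e = (i', 1)"
    and "\<lbrakk>t; r = 0\<rbrakk> \<Longrightarrow> \<exists>i'. i' \<noteq> 0 \<and> e = (i', 2 * s - 1)"
proof -
  obtain i' r' where e: "e = (i', r')" by force
  have eE: "(i', r') \<in> E" "node t (i, r) = node t (i', r')" "(i, r) \<noteq> (i', r')"
    using assms e by (auto simp: adj_def)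
  note c = same_node_cases[OF assms(1) eE]
  have E0: "r = 0 \<longleftrightarrow> i = 0" "r' = 0 \<longleftrightarrow> i' = 0" using assms(1) eE(1) by (auto simp: E_def)
  have os: "odd (2 * s - 1)" "2 * s - 1 \<noteq> 1" "2 * s - 1 \<noteq> 0" using s by (simp_all add: numeral_eq_Suc) presburger
  show "e = (i, r + 1)" if "t = odd r" "1 \<le> r" "r < 2 * s - 1"
    using c that e by (cases "odd r") auto
  show "e = (0, 0) \<or> (\<exists>i'. i' \<noteq> i \<and> i' \<noteq> 0 \<and> e = (i', 2 * s - 1))" if "t" "r = 2 * s - 1"
  proof -
    have "r' \<le> 2 * s - 1" using eE(1) by (auto simp: E_def)
    moreover have "\<not> (odd r' \<and> r = r' + 1)"
    proof
      assume "odd r' \<and> r = r' + 1"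
      then obtain q where "r = 2 * Suc q" by (auto elim!: oddE)
      then show False using that(2) last_odd by metis
    qed
    ultimately have "r' = 0 \<or> r' = 2 * s - 1" using c that by auto
    then show ?thesis using e E0 eE(3) that os by auto
  qed
  show "e = (i, r - 1)" if "t \<noteq> odd r" "2 \<le> r"
    using c that e os by (cases "odd r") auto
  show "e = (0, 0) \<or> (\<exists>i'. i' \<noteq> i \<and> i' \<noteq> 0 \<and> e = (i', 1))" if "\<not> t" "r = 1"
    using c that e E0 eE(3) by auto
  show "\<exists>i'. i' \<noteq> 0 \<and> e = (i', 1)" if "\<not> t" "r = 0"
    using c that e E0 eE(3) by auto
  show "\<exists>i'. i' \<noteq> 0 \<and> e = (i', 2 * s - 1)" if "t" "r = 0"
    using c that e E0 eE(3) os by auto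
qed

text \<open>On a petal a run without trivial syllables keeps its direction until it reaches an end.\<close>

lemma run_forward:
  assumes "run (i, r) (odd r) w f" "(i, r) \<in> E" "0 \<notin> set w" "1 \<le> r" "r + length w \<le> 2 * s - 1"
  shows "f = (i, r + length w)"
  using assms
proof (induction w arbitrary: r)
  case (Cons k w)
  then obtain e where e: "adj (odd r) (i, r) e" "run e (\<not> odd r) w f"
    using run_Cons_adj[of "(i, r)" "odd r" k w f] by auto
  then have "e = (i, r + 1)" using adj_cases(1)[OF Cons.prems(2) e(1)] Cons.prems by simp
  then show ?case using Cons.IH[of "r + 1"] e Cons.prems by (simp add: adj_def)
qed auto

lemma run_backward:
  assumes "run (i, r) (even r) w f" "(i, r) \<in> E" "0 \<notin> set w" "length w < r"
  shows "f = (i, r - length w)"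
  using assms
proof (induction w arbitrary: r)
  case (Cons k w)
  then obtain e where e: "adj (even r) (i, r) e" "run e (\<not> even r) w f"
    using run_Cons_adj[of "(i, r)" "even r" k w f] by auto
  then have "e = (i, r - 1)" using adj_cases(3)[OF Cons.prems(2) e(1)] Cons.prems by simp
  moreover have "even (r - 1) = (\<not> even r)" using Cons.prems by simp
  ultimately show ?case using Cons.IH[of "r - 1"] e Cons.prems by (simp add: adj_def)
qed auto

text \<open>A power of a leads from the base edge to the beginning of a petal, a power of b to its
  end; from there the run cannot turn back.\<close>

lemma run_from_base:
  assumes "run (0, 0) t w f" "0 \<notin> set w" "w \<noteq> []" "length w \<le> 2 * s - 1"
  shows "\<exists>i. i \<noteq> 0 \<and> f = (i, if t then 2 * s - length w else length w)"
proof -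
  obtain k v where w: "w = k # v" using assms(3) by (cases w) auto
  obtain e where e: "adj t (0, 0) e" "run e (\<not> t) v f"
    using run_Cons_adj[of "(0, 0)" t k v f] assms w by auto
  have E0: "(0, 0) \<in> E" by (simp add: E_def)
  have eE: "e \<in> E" using e by (simp add: adj_def)
  show ?thesis
  proof (cases t)
    case True
    then obtain i where i: "i \<noteq> 0" "e = (i, 2 * s - 1)" using adj_cases(6)[OF E0 e(1)] by auto
    have "\<not> even (2 * s - 1)" using s by presburger
    then have "f = (i, 2 * s - 1 - length v)"
      using run_backward[of i "2 * s - 1" v f] e(2) i eE True assms(2,4) w by auto
    then show ?thesis using True i w by auto
  next
    case False
    then obtain i where i: "i \<noteq> 0" "e = (i, 1)" using adj_cases(5)[OF E0 e(1)] by auto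
    then have "f = (i, 1 + length v)"
      using run_forward[of i 1 v f] e(2) i eE False assms(2,4) w by auto
    then show ?thesis using False i w by auto
  qed
qed

text \<open>A run that stays on its petal is monotone, hence not closed. If it leaves the petal and
  returns through the base edge, it has \<open>2 * s\<close> syllables, at least 20. If it passes
  directly to another petal, 11 syllables do not suffice to get off that one.\<close>

lemma closed_run_long:
  assumes e: "e \<in> E" and run: "run e t w e" and w: "w \<noteq> []" "0 \<notin> set w"
  shows "length w \<ge> 12"
proof (rule ccontr)
  assume "\<not> ?thesis"
  then have n: "length w \<le> 11" by simp
  obtain i r where ir: "e = (i, r)" by force
  have rE: "r \<le> 2 * s - 1" using e ir by (auto simp: E_def)
  have s20: "2 * s - 1 \<ge> 19" using s by simp
  show False
  proof (cases "r = 0")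
    case True
    then have "e = (0, 0)" using e ir by (auto simp: E_def)
    then show False using run_from_base[of t w e] run w n s20 by auto
  next
    case r: False
    then have i0: "i \<noteq> 0" using e ir by (auto simp: E_def)
    show False
    proof (cases "t = odd r")
      case fwd: True
      show False
      proof (cases "r + length w \<le> 2 * s - 1")
        case True
        then show False using run_forward[of i r w e] run fwd e ir w r by simp
      next
        case False
        define v where "v = take (2 * s - 1 - r) w"
        obtain k v' where v': "w = v @ k # v'"
        proof -
          have "length w > 2 * s - 1 - r" using False rE by linarith
          then have "w = v @ drop (2 * s - 1 - r) w" "drop (2 * s - 1 - r) w \<noteq> []"
            by (auto simp: v_def)
          then show thesis using that by (cases "drop (2 * s - 1 - r) w") auto
        qed
        have lv: "length v = 2 * s - 1 - r"
        proof -
          have "2 * s - 1 - r \<le> length w" using False by linarith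
          then show ?thesis by (simp add: v_def)
        qed
        let ?t = "if even (length v) then t else \<not> t"
        obtain g where g: "run e t v g" "run g ?t (k # v') e"
          using run unfolding v' run_append by blast
        have gE: "g \<in> E" using run_E[OF g(1) e] .
        have g': "g = (i, 2 * s - 1)"
          using run_forward[of i r v g] g(1) fwd e ir w r lv rE v' by simp
        have "odd (r + length v)" using lv rE s by simp
        then have t': "?t = True" using fwd by auto
        obtain h where h: "adj True (i, 2 * s - 1) h" "run h False v' e"
          using run_Cons_adj[OF g(2)[unfolded t' g']] w(2) v' by auto
        have hE: "h \<in> E" using h by (simp add: adj_def)
        have len: "length w = length v + 1 + length v'" using v' by simp
        consider "h = (0, 0)" | i' where "i' \<noteq> i" "h = (i', 2 * s - 1)"
          using adj_cases(2)[OF gE[unfolded g'] h(1)] by auto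
        then show False
        proof cases
          case 1
          show False
          proof (cases "v' = []")
            case True
            then show False using h(2) 1 ir i0 by simp
          next
            case False
            then have "r = length v'"
              using run_from_base[of False v' e] h(2) 1 ir w(2) v' len n s20 by auto
            then show False using len lv n s20 rE by linarith
          qed
        next
          case 2
          have "even (2 * s - 1) = False" using s by simp
          then have "e = (i', 2 * s - 1 - length v')"
            using run_backward[of i' "2 * s - 1" v' e] h(2) 2 hE w(2) v' len n s20 by auto
          then show False using ir 2 by simp
        qed
      qed
    next
      case bwd: False
      then have te: "t = even r" by auto
      show False
      proof (cases "length w < r")
        case True
        then have "r = r - length w" using run_backward[of i r w e] run te e ir w by simp
        then show False using True w(1) by (cases w) auto
      next
        case False
        define v where "v = take (r - 1) w"
        obtain k v' where v': "w = v @ k # v'"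
        proof -
          have "w = v @ drop (r - 1) w" "drop (r - 1) w \<noteq> []"
            using False r by (auto simp: v_def)
          then show thesis using that by (cases "drop (r - 1) w") auto
        qed
        have lv: "length v = r - 1" using False by (simp add: v_def)
        let ?t = "if even (length v) then t else \<not> t"
        obtain g where g: "run e t v g" "run g ?t (k # v') e"
          using run unfolding v' run_append by blast
        have gE: "g \<in> E" using run_E[OF g(1) e] .
        have g': "g = (i, 1)"
          using run_backward[of i r v g] g(1) te e ir w r lv v' by simp
        have t': "\<not> ?t" using te lv r by auto
        obtain h where h: "adj False (i, 1) h" "run h True v' e"
          using run_Cons_adj[OF g(2)] w(2) v' g' t' by auto
        have hE: "h \<in> E" using h by (simp add: adj_def)
        have len: "length w = length v + 1 + length v'" using v' by simp
        consider "h = (0, 0)" | i' where "i' \<noteq> i" "h = (i', 1)"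
          using adj_cases(4)[OF gE[unfolded g'] h(1)] by auto
        then show False
        proof cases
          case 1
          show False
          proof (cases "v' = []")
            case True
            then show False using h(2) 1 ir i0 by simp
          next
            case False
            then have "r = 2 * s - length v'"
              using run_from_base[of True v' e] h(2) 1 ir w(2) v' len n s20 by auto
            then show False using len lv n s20 rE by linarith
          qed
        next
          case 2
          then have "e = (i', 1 + length v')"
            using run_forward[of i' 1 v' e] h(2) hE w(2) v' len n s20 by auto
          then show False using ir 2 by simp
        qed
      qed
    qed
  qed
qed

section \<open>The subgroup preserves its subtree\<close>

lemma syll_sub:
  assumes i: "i \<in> {1..m}"
  shows "1 \<le> r \<Longrightarrow> r \<le> 2 * s - 1 \<Longrightarrow> act (syll i r) ` sub (i, r) = sub (0, 0)"
proof (induction r)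
  case (Suc r)
  let ?t = "odd r"
  let ?e = "if r = 0 then (0, 0) else (i, r)"
  have E: "?e \<in> E" "(i, Suc r) \<in> E" using i Suc.prems by (auto simp: E_def)
  have ne: "Suc r \<noteq> 2 * s - 1" if odd: "odd r"
  proof -
    obtain q where "r = 2 * q + 1" using odd by (rule oddE)
    then show ?thesis using last_odd[of "Suc q"] by simp
  qed
  have n: "node ?t ?e = node ?t (i, Suc r)" using Suc.prems ne by (auto simp: node_def elim!: oddE evenE)
  have o: "off ?t (i, Suc r) - off ?t ?e = kk ?t i (r div 2 + 1)"
    using Suc.prems ne by (auto simp: off_def elim!: oddE evenE)
  have step: "act (pw ?t (kk ?t i (r div 2 + 1))) ` sub (i, Suc r) = sub ?e"
    using pw_sub[OF E n] o by simp
  show ?case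
  proof (cases "r = 0")
    case True
    then show ?thesis using step by simp
  next
    case False
    then show ?thesis
      using Suc step image_act_mult[OF sub_verts, of "syll i r" "pw ?t (kk ?t i (r div 2 + 1))" "(i, Suc r)"] by simp
  qed
qed simp

lemma gens_sub:
  assumes i: "i \<in> {1..m}"
  shows "act (syll i (2 * s)) ` sub (0, 0) = sub (0, 0)"
proof -
  obtain s' where s': "s = Suc s'" using s by (cases s) auto
  let ?r = "Suc (2 * s')" and ?p = "pw True (kk True i s)"
  have r: "2 * s - 1 = ?r" using s' by simp
  have E: "(i, ?r) \<in> E" "(0, 0) \<in> E" using i r by (auto simp: E_def)
  have "node True (i, ?r) = node True (0, 0)" using r by (simp add: node_def)
  moreover have "off True (0, 0) - off True (i, ?r) = kk True i s" using r by (simp add: off_def)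
  ultimately have "act ?p ` sub (0, 0) = sub (i, ?r)" using pw_sub[OF E, of True] by simp
  moreover have "syll i (2 * s) = syll i ?r \<otimes>\<^bsub>F2\<^esub> ?p" using s' by simp
  moreover have "act (syll i ?r) ` sub (i, ?r) = sub (0, 0)" using syll_sub[OF i, of ?r] r by (simp del: syll.simps)
  ultimately show ?thesis using image_act_mult[OF sub_verts, of "syll i ?r" ?p "(0, 0)"] by (simp del: syll.simps)
qed

lemma C_stab:
  assumes "c \<in> C"
  shows "act c ` sub (0, 0) = sub (0, 0)"
  using assms unfolding C_def
proof (induction rule: generate.induct)
  case one
  then show ?case by (simp add: image_def)
next
  case (incl h)
  then obtain i where "i \<in> {1..m}" "h = syll i (2 * s)" by (auto simp: gens_def)
  then show ?case using gens_sub by simp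
next
  case (inv h)
  then obtain i where i: "i \<in> {1..m}" "h = syll i (2 * s)" by (auto simp: gens_def)
  then show ?case
    using image_act_inv(1)[of h, OF _ sub_verts[of "(0, 0)"]] gens_sub[OF i(1)] by simp
next
  case (eng h1 h2)
  then show ?case using image_act_mult[OF sub_verts, of h1 h2 "(0, 0)"] by simp
qed

sublocale rigid_automaton E node off "(0, 0)" u C
  by unfold_locales (use C_stab closed_run_long in blast)+

end

section \<open>The generators written in syllables\<close>

lemma listprod_snoc:
  assumes "group G" "x \<in> carrier G" "set xs \<subseteq> carrier G"
  shows "listprod G (xs @ [x]) = listprod G xs \<otimes>\<^bsub>G\<^esub> x"
proof -
  interpret group G by fact
  have "listprod G ys \<in> carrier G" if "set ys \<subseteq> carrier G" for ys
    using that by (induction ys) (auto simp: listprod_def)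
  then show ?thesis
    using assms(2,3) by (induction xs) (auto simp: listprod_def m_assoc)
qed

lemma (in petals) alpha_eq_syll:
  assumes "kk False = k1" "kk True = k2"
  shows "alpha k1 k2 n i = syll i (2 * n)"
proof (induction n)
  case 0
  then show ?case by (simp add: alpha_def listprod_def)
next
  case (Suc n)
  have g: "gen_a = gen False" "gen_b = gen True" by (simp_all add: gen_a_def gen_b_def gen_def)
  have "alpha k1 k2 (Suc n) i = alpha k1 k2 n i \<otimes>\<^bsub>F2\<^esub> (pw False (k1 i (Suc n)) \<otimes>\<^bsub>F2\<^esub> pw True (k2 i (Suc n)))"
    unfolding alpha_def g pw_def[symmetric]
    by (subst upt_Suc_append, simp, unfold map_append list.map, rule listprod_snoc)
      (auto intro: F2.is_group)
  then show ?case using Suc assms by (simp add: F2.m_assoc)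
qed

theorem mainTheorem6:
  fixes m s :: nat
    and k1 k2 :: "nat \<Rightarrow> nat \<Rightarrow> int"
    and eps1 eps2 :: "nat \<Rightarrow> int"
  assumes m: "m \<ge> 8" and s: "s \<ge> 10"
    and nz: "\<forall>i\<in>{1..m}. \<forall>j\<in>{1..s}. k1 i j \<noteq> 0 \<and> k2 i j \<noteq> 0"
    and A1: "inj_on (case_sum (\<lambda>(i, j). \<bar>k1 i j\<bar>) (\<lambda>(i, i'). \<bar>k1 i 1 - k1 i' 1\<bar>))
               (Inl ` ({1..m} \<times> {1..s}) \<union> Inr ` {(i, i'). 1 \<le> i \<and> i < i' \<and> i' \<le> m})"
    and A2: "inj_on (case_sum (\<lambda>(i, j). \<bar>k2 i j\<bar>) (\<lambda>(i, i'). \<bar>k2 i s - k2 i' s\<bar>))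
               (Inl ` ({1..m} \<times> {1..s}) \<union> Inr ` {(i, i'). 1 \<le> i \<and> i < i' \<and> i' \<le> m})"
    and B: "\<forall>i\<in>{1..8}. \<forall>j\<in>{1..s}. sgn (k1 i j) = eps1 i \<and> sgn (k2 i j) = eps2 i"
    and C1: "\<forall>i\<in>{1..4}. eps1 i = 1 \<and> eps2 i = 1"
    and C2: "\<forall>i\<in>{5..8}. eps1 i = 1 \<and> eps2 i = -1"
  shows "multi_malnormal F2 (generate F2 (alpha k1 k2 s ` {1..m}))"
proof -
  \<comment> \<open>The two halves of (A) become one hypothesis: the differences use the first
    exponents for a and the last ones for b.\<close>
  interpret petals m s "\<lambda>t. if t then k2 else k1"
  proof
    show "1 \<le> m" "10 \<le> s" using m s by auto
    fix i j t assume "i \<in> {1..m}" "j \<in> {1..s}"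
    then show "(if t then k2 else k1) i j \<noteq> 0" using nz by auto
  next
    fix t
    show "inj_on (case_sum (\<lambda>(i, j). \<bar>(if t then k2 else k1) i j\<bar>)
        (\<lambda>(i, i'). \<bar>(if t then k2 else k1) i (if t then s else 1) - (if t then k2 else k1) i' (if t then s else 1)\<bar>))
      (Inl ` ({1..m} \<times> {1..s}) \<union> Inr ` {(i, i'). 1 \<le> i \<and> i < i' \<and> i' \<le> m})"
      using A1 A2 by (cases t) simp_all
  qed
  have "alpha k1 k2 s ` {1..m} = gens"
    unfolding gens_def using alpha_eq_syll by simp
  then show ?thesis using C_multi_malnormal unfolding C_def by simp
qed

end
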